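(* Let $\mathcal{T}$ be a partially flat angled ideal triangulation of a compact orientable 3-manifold $M$. Then any connected closed 2-normal surface in $\mathcal{T}$ with non-negative Euler characteristic is normally parallel to a toral boundary component of $M$.
   Context: An ideal tetrahedron is a tetrahedron with its vertices removed. An ideal triangulation of a 3-manifold $M$ is an expression of the interior of $M$ as a union of ideal tetrahedra with their faces glued homeomorphically in pairs. Flat ideal tetrahedra. An ideal tetrahedron with a real number (interior angle) assigned to each of its six edges is flat if one pair of opposite edges have interior angle $\pi$ and the other four edges have interior angle $0$. Two faces of a flat ideal tetrahedron are coherent if they share an edge with interior angle $\pi$; thus the four faces are partitioned into two coherent pairs. Layered polygons. An elementary move on an ideal triangulation of a surface removes an edge adjacent to two distinct ideal triangles, forming an ideal square, and inserts the other diagonal of this square. A layered polygon is determined by an ideal polygon with an initial ideal triangulation, together with a finite sequence of elementary moves applied to this triangulation, such that every edge of the initial triangulation not in the boundary of the ideal polygon has a move performed upon it at some stage. It is built as follows: start with the initially triangulated ideal polygon as base; the first move acts on a pair of adjacent faces, and one attaches onto them a flat ideal tetrahedron along a coherent pair of faces (the edge to be removed being the edge of angle $\pi$ shared by this pair); the top of the resulting object inherits the second triangulation; repeat for each move of the sequence. The result is a 3-ball with finitely many boundary points removed. Its boundary is the union of two ideal polygons (initial/base and terminal/top), whose intersection is a collection of edges called its vertical boundary. A partially flat angled ideal triangulation of a 3-manifold is an ideal triangulation with a real number in $[0,\pi]$, called the interior angle, assigned to each edge of each ideal tetrahedron, such that: (i) the angles at each ideal vertex of each ideal tetrahedron sum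 to at most $\pi$; (ii) the angles around each edge sum to $2\pi$; (iii) if the angles of an ideal tetrahedron are not all strictly positive, then the ideal tetrahedron is flat; (iv) the union of the flat ideal tetrahedra is a collection of layered polygons, possibly with some edges in their vertical boundary identified. (Layered polygons may not meet each other or themselves along anything other than vertical boundary edges.) Normal and 2-normal surfaces. A normal disc in an ideal tetrahedron is a properly embedded disc that misses the vertices, hits each edge transversely in at most one point, and is not disjoint from the edges; it is either a triangle (separating one vertex from the other three) or a square (separating two vertices from the other two). An octagon is a properly embedded disc in an ideal tetrahedron whose boundary consists of eight normal arcs, meeting each edge of one pair of opposite edges in two points and each of the other four edges in one point. A surface is 2-normal if it is closed and embedded and intersects each ideal tetrahedron in a collection of normal discs and octagons. A 2-normal surface is normally parallel to a boundary component $B$ of $M$ if it is isotopic, through an isotopy preserving each cell of $\mathcal{T}$, to the surface made up of exactly one triangle around each ideal vertex of each ideal tetrahedron that corresponds to $B$ (the link of $B$). *)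

theory Defs
  imports "HOL-Analysis.Analysis" "HOL-Combinatorics.Permutations"
begin

text \<open>
  Everything is treated combinatorially: triangulations are gluing patterns of finitely many
  tetrahedra, and 2-normal surfaces are taken up to isotopy preserving each cell, so that such a
  surface is its trace on the 2-skeleton.
\<close>

definition equiv_gen :: "('b \<times> 'b) set \<Rightarrow> ('b \<times> 'b) set" where
  "equiv_gen r = (r \<union> r\<inverse>)\<^sup>*"


section \<open>Ideal triangulations\<close>

text \<open>
  The tetrahedra are the elements of a finite type \<open>'a\<close>, and the ideal vertices of each of them are
  the four elements of the numeral type \<open>4\<close>. Face \<open>f\<close> of a tetrahedron is the one opposite vertex
  \<open>f\<close>. Face \<open>f\<close> of \<open>t\<close> is glued to face \<open>perm T t f f\<close> of \<open>nbr T t f\<close>, a vertex \<open>v \<noteq> f\<close> of that face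
  going to \<open>perm T t f v\<close>.
\<close>

record 'a gluing =
  nbr :: "'a \<Rightarrow> 4 \<Rightarrow> 'a"
  perm :: "'a \<Rightarrow> 4 \<Rightarrow> 4 \<Rightarrow> 4"

text \<open>An edge of a tetrahedron, with an orientation, is a triple \<open>(t, u, v)\<close> with \<open>u \<noteq> v\<close>.\<close>

definition edge_rel :: "'a gluing \<Rightarrow> (('a \<times> 4 \<times> 4) \<times> ('a \<times> 4 \<times> 4)) set" where
  "edge_rel T = equiv_gen {((t, u, v), (nbr T t f, perm T t f u, perm T t f v)) | t u v f.
     u \<noteq> v \<and> f \<noteq> u \<and> f \<noteq> v}"

definition edge_class :: "'a gluing \<Rightarrow> 'a \<Rightarrow> 4 \<Rightarrow> 4 \<Rightarrow> ('a \<times> 4 \<times> 4) set" where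
  "edge_class T t u v = edge_rel T `` {(t, u, v)}"

text \<open>
  The space obtained from the glued tetrahedra by deleting the vertices is a 3-manifold iff no edge
  is identified with its own reverse. It is then the interior of a compact 3-manifold \<open>M\<close>, obtained
  by truncating the tetrahedra at their vertices.
\<close>

definition ideal_triangulation :: "'a gluing \<Rightarrow> bool" where
  "ideal_triangulation T \<longleftrightarrow>
     (\<forall>t f. bij (perm T t f)) \<and>
     (\<forall>t f. (nbr T t f, perm T t f f) \<noteq> (t, f)) \<and>
     (\<forall>t f. nbr T (nbr T t f) (perm T t f f) = t) \<and>
     (\<forall>t f. perm T (nbr T t f) (perm T t f f) = inv (perm T t f)) \<and>
     (\<forall>t u v. u \<noteq> v \<longrightarrow> (t, v, u) \<notin> edge_class T t u v)"

text \<open>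
  \<open>\<epsilon> t\<close> says whether the labelling of the vertices of \<open>t\<close> is positive. If \<open>perm T t f\<close> is even, then
  the labelling of \<open>nbr T t f\<close> is the mirror image of that of \<open>t\<close>: a transposition of labels, or a
  reflection in the common face, reverses the sense of a labelling.
\<close>

definition orientable :: "'a gluing \<Rightarrow> bool" where
  "orientable T \<longleftrightarrow> (\<exists>\<epsilon> :: 'a \<Rightarrow> bool. \<forall>t f.
     sign (perm T t f) = (if \<epsilon> (nbr T t f) = \<epsilon> t then - 1 else 1))"

text \<open>The boundary components of \<open>M\<close> correspond to the classes of identified ideal vertices.\<close>

definition boundary_components :: "'a gluing \<Rightarrow> ('a \<times> 4) set set" where
  "boundary_components T =
     UNIV // equiv_gen {((t, v), (nbr T t f, perm T t f v)) | t v f. f \<noteq> v}"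


section \<open>Layered polygons\<close>

text \<open>
  A polygon has corners \<open>0, \<dots>, n - 1\<close> in cyclic order. Up to isotopy an arc joining two corners is
  the pair of its ends, and an ideal triangulation is a maximal family of such arcs without
  crossings, the sides of the polygon included.
\<close>

definition polygon_arcs :: "nat \<Rightarrow> nat set set" where
  "polygon_arcs n = {{i, j} | i j. i < j \<and> j < n}"

definition polygon_sides :: "nat \<Rightarrow> nat set set" where
  "polygon_sides n = {{i, Suc i mod n} | i. i < n}"

definition arcs_cross :: "nat set \<Rightarrow> nat set \<Rightarrow> bool" where
  "arcs_cross p q \<longleftrightarrow> (\<exists>i k j l. i < k \<and> k < j \<and> j < l \<and>
     (p = {i, j} \<and> q = {k, l} \<or> q = {i, j} \<and> p = {k, l}))"

definition polygon_triangulation :: "nat \<Rightarrow> nat set set \<Rightarrow> bool" where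
  "polygon_triangulation n E \<longleftrightarrow> n \<ge> 3 \<and> E \<subseteq> polygon_arcs n \<and>
     (\<forall>p\<in>E. \<forall>q\<in>E. \<not> arcs_cross p q) \<and>
     (\<forall>p\<in>polygon_arcs n - E. \<exists>q\<in>E. arcs_cross p q)"

text \<open>
  The elementary move \<open>(a, b, c, d)\<close> acts on the square with corners \<open>a, b, c, d\<close> in cyclic order
  (either way round), replacing its diagonal \<open>ac\<close> by \<open>bd\<close>. The flat tetrahedron attached for this
  move has the angle \<open>\<pi>\<close> at \<open>ac\<close> and \<open>bd\<close>; its lower coherent pair of faces is \<open>abc, acd\<close>, its upper
  one \<open>abd, bcd\<close>.
\<close>

type_synonym move = "nat \<times> nat \<times> nat \<times> nat"

fun corners :: "move \<Rightarrow> nat set" where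
  "corners (a, b, c, d) = {a, b, c, d}"

fun removed :: "move \<Rightarrow> nat set" where
  "removed (a, b, c, d) = {a, c}"

fun inserted :: "move \<Rightarrow> nat set" where
  "inserted (a, b, c, d) = {b, d}"

fun lower_faces :: "move \<Rightarrow> nat set set" where
  "lower_faces (a, b, c, d) = {{a, b, c}, {a, c, d}}"

fun upper_faces :: "move \<Rightarrow> nat set set" where
  "upper_faces (a, b, c, d) = {{a, b, d}, {b, c, d}}"

fun move_applicable :: "nat set set \<Rightarrow> move \<Rightarrow> bool" where
  "move_applicable E (a, b, c, d) \<longleftrightarrow> distinct [a, b, c, d] \<and>
     {{a, c}, {a, b}, {b, c}, {c, d}, {d, a}} \<subseteq> E"

record layering =
  nsides :: nat
  initial :: "nat set set"
  moves :: "move list"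

primrec stage :: "layering \<Rightarrow> nat \<Rightarrow> nat set set" where
  "stage P 0 = initial P"
| "stage P (Suc k) =
     insert (inserted (moves P ! k)) (stage P k - {removed (moves P ! k)})"

definition layered_polygon :: "layering \<Rightarrow> bool" where
  "layered_polygon P \<longleftrightarrow>
     polygon_triangulation (nsides P) (initial P) \<and>
     (\<forall>k<length (moves P). move_applicable (stage P k) (moves P ! k)) \<and>
     (\<forall>e\<in>initial P - polygon_sides (nsides P). \<exists>k<length (moves P). removed (moves P ! k) = e)"

text \<open>
  The tetrahedra of the layered polygon are numbered by the moves. The same triple of corners may
  span a face several times over, when moves undo one another: an upper face \<open>F\<close> of tetrahedron \<open>i\<close>
  is glued to the first later tetrahedron having \<open>F\<close> as a lower face. Similarly an arc \<open>e\<close> in two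
  tetrahedra \<open>i\<close> and \<open>j\<close> is one and the same edge iff \<open>e\<close> is not removed in between.
\<close>

definition glued_in :: "layering \<Rightarrow> nat \<Rightarrow> nat \<Rightarrow> nat set \<Rightarrow> bool" where
  "glued_in P i j F \<longleftrightarrow> i < j \<and> j < length (moves P) \<and>
     F \<in> upper_faces (moves P ! i) \<and> F \<in> lower_faces (moves P ! j) \<and>
     (\<forall>k. i < k \<and> k < j \<longrightarrow> F \<notin> lower_faces (moves P ! k))"

definition same_edge_in :: "layering \<Rightarrow> nat \<Rightarrow> nat \<Rightarrow> nat set \<Rightarrow> bool" where
  "same_edge_in P i j e \<longleftrightarrow> (\<forall>k. min i j \<le> k \<and> k < max i j \<longrightarrow> removed (moves P ! k) \<noteq> e)"


section \<open>Partially flat angled ideal triangulations\<close>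

text \<open>The pair \<open>{x, y}\<close> is the edge \<open>{u, v}\<close> or the opposite edge.\<close>

definition same_or_opposite :: "4 \<Rightarrow> 4 \<Rightarrow> 4 \<Rightarrow> 4 \<Rightarrow> bool" where
  "same_or_opposite u v x y \<longleftrightarrow> {x, y} = {u, v} \<or> {x, y} \<inter> {u, v} = {}"

text \<open>\<open>\<theta> t u v\<close> is the interior angle of \<open>t\<close> at the edge \<open>uv\<close>.\<close>

definition flat :: "('a \<Rightarrow> 4 \<Rightarrow> 4 \<Rightarrow> real) \<Rightarrow> 'a \<Rightarrow> bool" where
  "flat \<theta> t \<longleftrightarrow> (\<exists>u v. u \<noteq> v \<and> (\<forall>x y. x \<noteq> y \<longrightarrow>
     \<theta> t x y = (if same_or_opposite u v x y then pi else 0)))"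

text \<open>
  The layered polygons \<open>Ps\<close> are placed in \<open>T\<close> by sending tetrahedron \<open>i\<close> of the \<open>j\<close>-th one to
  \<open>pos j i\<close>, whose vertices are the corners \<open>lab j i\<close>. Two faces of flat tetrahedra are glued in \<open>T\<close>
  exactly if they are glued within one layered polygon. Two distinct edges of the disjoint union of
  the layered polygons are identified in \<open>T\<close> only if both are vertical boundary edges; as every
  initial arc that is not a side is removed at some stage, the vertical boundary of a layered
  polygon consists of the sides.
\<close>

definition layered_by :: "'a gluing \<Rightarrow> ('a \<Rightarrow> 4 \<Rightarrow> 4 \<Rightarrow> real) \<Rightarrow> layering list \<Rightarrow>
    (nat \<Rightarrow> nat \<Rightarrow> 'a) \<Rightarrow> (nat \<Rightarrow> nat \<Rightarrow> 4 \<Rightarrow> nat) \<Rightarrow> bool" where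
  "layered_by T \<theta> Ps pos lab \<longleftrightarrow>
     (let I = {(j, i). j < length Ps \<and> i < length (moves (Ps ! j))} in
     (\<forall>P\<in>set Ps. layered_polygon P) \<and>
     bij_betw (\<lambda>(j, i). pos j i) I {t. flat \<theta> t} \<and>
     (\<forall>(j, i)\<in>I. bij_betw (lab j i) UNIV (corners (moves (Ps ! j) ! i))) \<and>
     (\<forall>(j, i)\<in>I. \<forall>u v. u \<noteq> v \<longrightarrow>
        \<theta> (pos j i) u v =
          (if lab j i ` {u, v} \<in> {removed (moves (Ps ! j) ! i), inserted (moves (Ps ! j) ! i)}
           then pi else 0)) \<and>
     (\<forall>(j, i)\<in>I. \<forall>i' f. glued_in (Ps ! j) i i' (lab j i ` (- {f})) \<longrightarrow>
        nbr T (pos j i) f = pos j i' \<and>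
        (\<forall>v. v \<noteq> f \<longrightarrow> lab j i' (perm T (pos j i) f v) = lab j i v)) \<and>
     (\<forall>(j, i)\<in>I. \<forall>f. flat \<theta> (nbr T (pos j i) f) \<longrightarrow>
        (\<exists>i'. glued_in (Ps ! j) i i' (lab j i ` (- {f})) \<or>
              (j, i') \<in> I \<and> glued_in (Ps ! j) i' i (lab j i ` (- {f})))) \<and>
     (\<forall>(j, i)\<in>I. \<forall>(j', i')\<in>I. \<forall>u v u' v'.
        u \<noteq> v \<and> u' \<noteq> v' \<and> (pos j' i', u', v') \<in> edge_class T (pos j i) u v \<longrightarrow>
        lab j i ` {u, v} \<in> polygon_sides (nsides (Ps ! j)) \<and>
          lab j' i' ` {u', v'} \<in> polygon_sides (nsides (Ps ! j')) \<or>
        j = j' \<and> lab j i ` {u, v} = lab j i' ` {u', v'} \<and>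
          same_edge_in (Ps ! j) i i' (lab j i ` {u, v})))"

text \<open>
  In the sum around an edge, each edge of a tetrahedron that is identified with \<open>uv\<close> is counted
  once, since exactly one of its two orientations lies in \<open>edge_class T t u v\<close>.
\<close>

definition partially_flat_angled :: "'a gluing \<Rightarrow> ('a \<Rightarrow> 4 \<Rightarrow> 4 \<Rightarrow> real) \<Rightarrow> bool" where
  "partially_flat_angled T \<theta> \<longleftrightarrow>
     ideal_triangulation T \<and>
     (\<forall>t u v. u \<noteq> v \<longrightarrow> \<theta> t u v = \<theta> t v u \<and> 0 \<le> \<theta> t u v \<and> \<theta> t u v \<le> pi) \<and>
     (\<forall>t u. (\<Sum>v\<in>- {u}. \<theta> t u v) \<le> pi) \<and>
     (\<forall>t u v. u \<noteq> v \<longrightarrow> (\<Sum>(t', x, y)\<in>edge_class T t u v. \<theta> t' x y) = 2 * pi) \<and>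
     (\<forall>t. (\<forall>u v. u \<noteq> v \<longrightarrow> \<theta> t u v > 0) \<or> flat \<theta> t) \<and>
     (\<exists>Ps pos lab. layered_by T \<theta> Ps pos lab)"


section \<open>2-normal surfaces\<close>

text \<open>
  A 2-normal surface \<open>S\<close> meets every face in finitely many disjoint normal arcs. Those in face \<open>f\<close> of
  \<open>t\<close> which cut off the vertex \<open>v\<close> are nested, and are numbered \<open>0, \<dots>, arcs S t f v - 1\<close> outwards
  from \<open>v\<close>. The number of points of \<open>S\<close> on the edge \<open>uv\<close> of \<open>t\<close> is \<open>points S t u v\<close>, and
  \<open>(t, u, v, k)\<close> is the \<open>k\<close>-th of these, counted from \<open>u\<close>. Thus arc number \<open>k\<close> at \<open>v\<close> in \<open>f\<close> joins
  \<open>(t, v, u, k)\<close> to \<open>(t, v, x, k)\<close>, where \<open>u\<close> and \<open>x\<close> are the other vertices of \<open>f\<close>. These numbers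
  describe the trace of \<open>S\<close> on the 2-skeleton up to isotopy preserving each cell.

  In the boundary of \<open>t\<close> the arcs form disjoint closed curves. Such curves bound disjoint properly
  embedded discs in \<open>t\<close>, unique up to isotopy, and these are the components of the intersection of
  \<open>S\<close> with \<open>t\<close>. A disc is represented by the set of all points on its boundary curve.
\<close>

record 'a surface =
  points :: "'a \<Rightarrow> 4 \<Rightarrow> 4 \<Rightarrow> nat"
  arcs :: "'a \<Rightarrow> 4 \<Rightarrow> 4 \<Rightarrow> nat"

type_synonym 'a point = "'a \<times> 4 \<times> 4 \<times> nat"

definition surface_points :: "'a surface \<Rightarrow> 'a point set" where
  "surface_points S = {(t, u, v, k) | t u v k. u \<noteq> v \<and> k < points S t u v}"

definition surface_arcs :: "'a surface \<Rightarrow> 'a point set" where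
  "surface_arcs S = {(t, f, v, k) | t f v k. v \<noteq> f \<and> k < arcs S t f v}"

text \<open>Counting from \<open>u\<close> and counting from \<open>v\<close>\<close>

definition flip_rel :: "'a surface \<Rightarrow> ('a point \<times> 'a point) set" where
  "flip_rel S = {((t, u, v, k), (t, v, u, points S t u v - 1 - k)) | t u v k.
     (t, u, v, k) \<in> surface_points S}"

definition glue_rel :: "'a gluing \<Rightarrow> 'a surface \<Rightarrow> ('a point \<times> 'a point) set" where
  "glue_rel T S = {((t, u, v, k), (nbr T t f, perm T t f u, perm T t f v, k)) | t u v k f.
     (t, u, v, k) \<in> surface_points S \<and> f \<noteq> u \<and> f \<noteq> v}"

definition arc_rel :: "'a surface \<Rightarrow> ('a point \<times> 'a point) set" where
  "arc_rel S = {((t, v, u, k), (t, v, x, k)) | t f v u x k.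
     distinct [f, v, u, x] \<and> (t, f, v, k) \<in> surface_arcs S}"

definition discs :: "'a surface \<Rightarrow> 'a point set set" where
  "discs S = surface_points S // equiv_gen (flip_rel S \<union> arc_rel S)"

definition hits :: "'a point set \<Rightarrow> 4 \<Rightarrow> 4 \<Rightarrow> nat" where
  "hits c u v = card {(t, k). (t, u, v, k) \<in> c}"

definition normal_disc :: "'a point set \<Rightarrow> bool" where
  "normal_disc c \<longleftrightarrow> (\<forall>u v. u \<noteq> v \<longrightarrow> hits c u v \<le> 1)"

definition octagon :: "'a point set \<Rightarrow> bool" where
  "octagon c \<longleftrightarrow> (\<exists>u v. u \<noteq> v \<and> (\<forall>x y. x \<noteq> y \<longrightarrow>
     hits c x y = (if same_or_opposite u v x y then 2 else 1)))"

definition two_normal_surface :: "'a gluing \<Rightarrow> 'a surface \<Rightarrow> bool" where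
  "two_normal_surface T S \<longleftrightarrow>
     (\<forall>t f u v. distinct [f, u, v] \<longrightarrow> points S t u v = arcs S t f u + arcs S t f v) \<and>
     (\<forall>t f u v. distinct [f, u, v] \<longrightarrow>
        points S (nbr T t f) (perm T t f u) (perm T t f v) = points S t u v) \<and>
     (\<forall>t f v. v \<noteq> f \<longrightarrow> arcs S (nbr T t f) (perm T t f f) (perm T t f v) = arcs S t f v) \<and>
     (\<forall>c\<in>discs S. normal_disc c \<or> octagon c)"

text \<open>The Euler characteristic of the cell structure given by points, arcs and discs\<close>

definition euler_characteristic :: "'a gluing \<Rightarrow> 'a surface \<Rightarrow> int" where
  "euler_characteristic T S =
     int (card (surface_points S // equiv_gen (flip_rel S \<union> glue_rel T S)))
     - int (card (surface_arcs S //
         equiv_gen {((t, f, v, k), (nbr T t f, perm T t f f, perm T t f v, k)) | t f v k.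
           (t, f, v, k) \<in> surface_arcs S}))
     + int (card (discs S))"

text \<open>As every disc has points on its boundary, connectedness can be read off the 1-skeleton of \<open>S\<close>.\<close>

definition connected_surface :: "'a gluing \<Rightarrow> 'a surface \<Rightarrow> bool" where
  "connected_surface T S \<longleftrightarrow> surface_points S \<noteq> {} \<and>
     (\<forall>p\<in>surface_points S. \<forall>q\<in>surface_points S.
        (p, q) \<in> equiv_gen (flip_rel S \<union> glue_rel T S \<union> arc_rel S))"

text \<open>
  For \<open>f, v, u, x\<close> distinct, \<open>(t, f, v, u, k)\<close> is arc \<open>k\<close> at \<open>v\<close> in face \<open>f\<close> of \<open>t\<close>, traversed from
  \<open>vu\<close> to \<open>vx\<close> as part of the boundary of the adjacent disc in \<open>t\<close>. An orientation of \<open>S\<close> is the set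
  \<open>D\<close> of those arcs traversed positively with respect to that disc. Of the two arcs of a disc which
  emanate from a given point, in the faces \<open>f\<close> and \<open>g\<close>, exactly one is in \<open>D\<close>; and the two discs at
  an arc of \<open>S\<close> induce opposite directions on it.
\<close>

definition orientable_surface :: "'a gluing \<Rightarrow> 'a surface \<Rightarrow> bool" where
  "orientable_surface T S \<longleftrightarrow> (\<exists>D :: ('a \<times> 4 \<times> 4 \<times> 4 \<times> nat) set.
     (\<forall>t f v u x k. distinct [f, v, u, x] \<and> (t, f, v, k) \<in> surface_arcs S \<longrightarrow>
        ((t, f, v, u, k) \<in> D \<longleftrightarrow> (t, f, v, x, k) \<notin> D) \<and>
        ((t, f, v, u, k) \<in> D \<longleftrightarrow>
           (nbr T t f, perm T t f f, perm T t f v, perm T t f u, k) \<notin> D)) \<and>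
     (\<forall>t f g v u v' u' k k'.
        distinct [f, v, u] \<and> distinct [g, v', u'] \<and> f \<noteq> g \<and>
        (t, f, v, k) \<in> surface_arcs S \<and> (t, g, v', k') \<in> surface_arcs S \<and>
        ((t, v, u, k), (t, v', u', k')) \<in> (flip_rel S)\<^sup>= \<longrightarrow>
        ((t, f, v, u, k) \<in> D \<longleftrightarrow> (t, g, v', u', k') \<notin> D)))"

definition torus :: "'a gluing \<Rightarrow> 'a surface \<Rightarrow> bool" where
  "torus T S \<longleftrightarrow> connected_surface T S \<and> orientable_surface T S \<and> euler_characteristic T S = 0"

text \<open>
  The link of a boundary component \<open>B\<close>, which is a copy of \<open>B\<close>: one triangle around each vertex
  \<open>(t, v) \<in> B\<close>, which has one arc in each face of \<open>t\<close> containing \<open>v\<close>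
\<close>

definition link :: "('a \<times> 4) set \<Rightarrow> 'a surface" where
  "link B = \<lparr>points = (\<lambda>t u v. of_bool ((t, u) \<in> B) + of_bool ((t, v) \<in> B)),
             arcs = (\<lambda>t f v. of_bool ((t, v) \<in> B))\<rparr>"

text \<open>Isotopy preserving each cell\<close>

definition normally_isotopic :: "'a surface \<Rightarrow> 'a surface \<Rightarrow> bool" where
  "normally_isotopic S S' \<longleftrightarrow>
     (\<forall>t u v. u \<noteq> v \<longrightarrow> points S t u v = points S' t u v) \<and>
     (\<forall>t f v. v \<noteq> f \<longrightarrow> arcs S t f v = arcs S' t f v)"

definition normally_parallel :: "'a surface \<Rightarrow> ('a \<times> 4) set \<Rightarrow> bool" where
  "normally_parallel S B \<longleftrightarrow> normally_isotopic S (link B)"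

end

theory Submission
  imports Defs
begin

text \<open>
  Give a disc of \<open>S\<close> with boundary points \<open>p\<close> the area \<open>\<Sum> (\<pi> - \<theta> p) - 2 \<pi>\<close>. As the angles around an
  edge sum to \<open>2 \<pi>\<close>, the areas sum to \<open>- 2 \<pi> \<chi>(S)\<close>, and the angle conditions make all areas
  non-negative. Hence all areas vanish. This leaves triangles, and squares that miss a pair of edges
  of angle \<open>0\<close>, which exist only in flat tetrahedra.

  Such a square meets the edge removed by its elementary move. Take the earliest flat tetrahedron of
  a layered polygon that contains a square, and a point of the square on the removed edge. Around the
  edge, all other tetrahedra are either not flat or earlier in the polygon, so \<open>S\<close> meets them in
  triangles only. Going around the point, the arcs of \<open>S\<close> in successive faces cut off the same end of
  the edge across a triangle but opposite ends across a square, so the number of squares at the point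
  is even, a contradiction. A connected surface consisting of triangles is a vertex link.
\<close>

section \<open>Generated equivalence relations\<close>

lemma equiv_equiv_gen: "equiv UNIV (equiv_gen r)"
  unfolding equiv_gen_def
  by (intro equivI sym_rtrancl sym_Un_converse trans_rtrancl refl_rtrancl) auto

lemma equiv_gen_refl [simp]: "(x, x) \<in> equiv_gen r"
  by (simp add: equiv_gen_def)

lemma equiv_gen_sym: "(x, y) \<in> equiv_gen r \<Longrightarrow> (y, x) \<in> equiv_gen r"
  using equiv_equiv_gen[of r] by (auto elim: equivE dest: symD)

lemma equiv_gen_trans:
  "(x, y) \<in> equiv_gen r \<Longrightarrow> (y, z) \<in> equiv_gen r \<Longrightarrow> (x, z) \<in> equiv_gen r"
  using equiv_equiv_gen[of r] by (auto elim: equivE dest: transD)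

lemma equiv_gen_base: "(x, y) \<in> r \<Longrightarrow> (x, y) \<in> equiv_gen r"
  unfolding equiv_gen_def by auto

lemma equiv_gen_invariant:
  assumes "(x, y) \<in> equiv_gen r" and step: "\<And>x y. (x, y) \<in> r \<Longrightarrow> P x = P y"
  shows "P x = P y"
  using assms(1) unfolding equiv_gen_def
  by (induction rule: rtrancl_induct) (use step in \<open>force+\<close>)

lemma equiv_gen_class_subset:
  assumes "\<And>x y. (x, y) \<in> r \<Longrightarrow> x \<in> A \<longleftrightarrow> y \<in> A" and "c \<in> A // equiv_gen r"
  shows "c \<subseteq> A"
proof
  fix y assume "y \<in> c"
  with assms(2) obtain x where "x \<in> A" "(x, y) \<in> equiv_gen r" by (auto elim!: quotientE)
  with equiv_gen_invariant[of x y r "\<lambda>x. x \<in> A"] assms(1) show "y \<in> A" by blast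
qed

text \<open>Closure of \<open>A\<close> under \<open>r\<close> keeps the classes of its elements
  inside \<open>A\<close>, so they partition it. The points of \<open>S\<close> are summed in this
  way twice, by vertices and by discs.\<close>

lemma sum_equiv_gen_classes:
  assumes "finite A" and A: "\<And>x y. (x, y) \<in> r \<Longrightarrow> x \<in> A \<longleftrightarrow> y \<in> A"
  shows "(\<Sum>c\<in>A // equiv_gen r. sum f c) = sum f A"
proof -
  have "\<Union> (A // equiv_gen r) = A"
  proof
    show "\<Union> (A // equiv_gen r) \<subseteq> A" using equiv_gen_class_subset[OF A] by blast
    show "A \<subseteq> \<Union> (A // equiv_gen r)" by (force simp: quotient_def)
  qed
  moreover have "sum f (\<Union> (A // equiv_gen r)) = (\<Sum>c\<in>A // equiv_gen r. sum f c)"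
  proof (subst sum.Union_disjoint)
    show "\<forall>c\<in>A // equiv_gen r. finite c"
      using equiv_gen_class_subset[OF A] \<open>finite A\<close> by (meson finite_subset)
    show "\<forall>c\<in>A // equiv_gen r. \<forall>d\<in>A // equiv_gen r. c \<noteq> d \<longrightarrow> c \<inter> d = {}"
      using quotient_disj[OF equiv_equiv_gen[of r]] by (auto simp: quotient_def)
  qed auto
  ultimately show ?thesis by simp
qed

lemma finite_equiv_gen_classes: "finite A \<Longrightarrow> finite (A // equiv_gen r)"
  by (simp add: quotient_def)

text \<open>Every orbit has exactly two elements. This serves to count the arcs of \<open>S\<close>,
  each shared by two faces glued together, and gives the parity argument around an edge.\<close>

lemma card_involution_classes:
  assumes "finite A" and \<phi>: "\<And>x. x \<in> A \<Longrightarrow> \<phi> x \<in> A \<and> \<phi> (\<phi> x) = x \<and> \<phi> x \<noteq> x"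
  shows "card A = 2 * card (A // equiv_gen {(x, \<phi> x) | x. x \<in> A})"
proof -
  let ?r = "{(x, \<phi> x) | x. x \<in> A}"
  have A: "x \<in> A \<longleftrightarrow> y \<in> A" if "(x, y) \<in> ?r" for x y
    using that \<phi> by auto
  have "card c = 2" if "c \<in> A // equiv_gen ?r" for c
  proof -
    from that obtain x where x: "x \<in> A" "c = equiv_gen ?r `` {x}" by (auto elim: quotientE)
    have "c = {x, \<phi> x}"
    proof
      show "c \<subseteq> {x, \<phi> x}"
      proof
        fix y assume "y \<in> c"
        then have "(x, y) \<in> equiv_gen ?r" using x by simp
        then have "(x \<in> {x, \<phi> x}) = (y \<in> {x, \<phi> x})"
        proof (rule equiv_gen_invariant)
          fix z w assume "(z, w) \<in> ?r"
          then have "w = \<phi> z" "\<phi> w = z" using \<phi> by auto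
          with \<phi>[OF x(1)] have "z = x \<longleftrightarrow> w = \<phi> x" "z = \<phi> x \<longleftrightarrow> w = x" by metis+
          then show "(z \<in> {x, \<phi> x}) = (w \<in> {x, \<phi> x})" by blast
        qed
        then show "y \<in> {x, \<phi> x}" by simp
      qed
      show "{x, \<phi> x} \<subseteq> c" using x by (auto intro: equiv_gen_base)
    qed
    with \<phi>[OF x(1)] show ?thesis by auto
  qed
  moreover have "(\<Sum>c\<in>A // equiv_gen ?r. card c) = card A"
    using sum_equiv_gen_classes[where r = ?r and f = "\<lambda>_. 1::nat", OF assms(1) A] by auto
  ultimately show ?thesis by simp
qed

lemma even_card_involution:
  assumes "finite A" and \<phi>: "\<And>x. x \<in> A \<Longrightarrow> \<phi> x \<in> A \<and> \<phi> (\<phi> x) = x \<and> \<phi> x \<noteq> x"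
  shows "even (card A)"
  using card_involution_classes[OF assms] by simp


section \<open>The vertices of a tetrahedron\<close>

lemma four_UNIV:
  fixes a b c d :: 4
  assumes "distinct [a, b, c, d]"
  shows "UNIV = {a, b, c, d}"
proof -
  have "card {a, b, c, d} = CARD(4)" using assms by simp
  then show ?thesis by (metis card_subset_eq finite subset_UNIV)
qed

lemma four_cases:
  fixes a b c d u :: 4
  assumes "distinct [a, b, c, d]"
  shows "u = a \<or> u = b \<or> u = c \<or> u = d"
  using four_UNIV[OF assms] by blast

lemma four_extend1:
  fixes a b c :: 4
  assumes "distinct [a, b, c]"
  obtains d where "distinct [a, b, c, d]"
proof -
  have "card {a, b, c} < CARD(4)" using assms by simp
  then have "{a, b, c} \<noteq> UNIV" by (metis less_irrefl)
  then obtain d where "d \<notin> {a, b, c}" by blast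
  then show ?thesis using that[of d] assms by auto
qed

lemma four_extend2:
  fixes a b :: 4
  assumes "a \<noteq> b"
  obtains c d where "distinct [a, b, c, d]"
proof -
  have "card {a, b} < CARD(4)" using assms by simp
  then have "{a, b} \<noteq> UNIV" by (metis less_irrefl)
  then obtain c where "c \<notin> {a, b}" by blast
  then have "distinct [a, b, c]" using assms by auto
  then obtain d where "distinct [a, b, c, d]" by (rule four_extend1)
  then show ?thesis by (rule that)
qed

lemma sum_four_pairs:
  fixes g :: "4 \<Rightarrow> 4 \<Rightarrow> 'b::comm_monoid_add"
  assumes d: "distinct [a, b, c, d]"
  shows "(\<Sum>u\<in>UNIV. \<Sum>v\<in>- {u}. g u v) =
    (g a b + g a c + g a d) + (g b a + g b c + g b d) + (g c a + g c b + g c d) + (g d a + g d b + g d c)"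
proof -
  \<comment> \<open>\<open>distinct_rev\<close> provides each inequality with its sides exchanged as
    well.\<close>
  have c: "- {a} = {b, c, d}" "- {b} = {a, c, d}" "- {c} = {a, b, d}" "- {d} = {a, b, c}"
    using d distinct_rev[of "[a, b, c, d]"]
    unfolding Compl_eq_Diff_UNIV four_UNIV[OF d] by (simp_all add: insert_Diff_if)
  have "(\<Sum>u\<in>UNIV. \<Sum>v\<in>- {u}. g u v) = (\<Sum>u\<in>{a, b, c, d}. \<Sum>v\<in>- {u}. g u v)"
    by (simp only: four_UNIV[OF d])
  also have "\<dots> = (\<Sum>v\<in>{b, c, d}. g a v) + (\<Sum>v\<in>{a, c, d}. g b v)
      + (\<Sum>v\<in>{a, b, d}. g c v) + (\<Sum>v\<in>{a, b, c}. g d v)"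
    using d by (simp add: c add.assoc)
  also have "\<dots> = (g a b + g a c + g a d) + (g b a + g b c + g b d)
      + (g c a + g c b + g c d) + (g d a + g d b + g d c)"
    using d by (simp add: add.assoc)
  finally show ?thesis .
qed

lemma same_or_opposite_cases:
  assumes d: "distinct [a, b, c, d]"
  shows "same_or_opposite a b a b" "same_or_opposite a b b a"
    "same_or_opposite a b c d" "same_or_opposite a b d c"
    "\<not> same_or_opposite a b a c" "\<not> same_or_opposite a b c a"
    "\<not> same_or_opposite a b a d" "\<not> same_or_opposite a b d a"
    "\<not> same_or_opposite a b b c" "\<not> same_or_opposite a b c b"
    "\<not> same_or_opposite a b b d" "\<not> same_or_opposite a b d b"
  using d distinct_rev[of "[a, b, c, d]"] by (simp_all add: same_or_opposite_def doubleton_eq_iff)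

text \<open>
  The edge intersection numbers \<open>h\<close> of a curve in the boundary of a tetrahedron are even on each
  face, so for \<open>h \<le> 1\<close> they form a cut of the complete graph on the four vertices.
\<close>

definition triangle_pattern :: "(4 \<Rightarrow> 4 \<Rightarrow> nat) \<Rightarrow> 4 \<Rightarrow> bool" where
  "triangle_pattern h w \<longleftrightarrow> (\<forall>x y. x \<noteq> y \<longrightarrow> h x y = (if w \<in> {x, y} then 1 else 0))"

text \<open>The square is named by an edge \<open>uv\<close> that it misses, so \<open>u\<close> and
  \<open>v\<close> lie on the same side of it.\<close>

definition square_pattern :: "(4 \<Rightarrow> 4 \<Rightarrow> nat) \<Rightarrow> 4 \<Rightarrow> 4 \<Rightarrow> bool" where
  "square_pattern h u v \<longleftrightarrow> u \<noteq> v \<and>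
     (\<forall>x y. x \<noteq> y \<longrightarrow> h x y = (if same_or_opposite u v x y then 0 else 1))"

lemma even_pattern_cases:
  fixes h :: "4 \<Rightarrow> 4 \<Rightarrow> nat"
  assumes sym: "\<And>u v. u \<noteq> v \<Longrightarrow> h u v = h v u"
    and le: "\<And>u v. u \<noteq> v \<Longrightarrow> h u v \<le> 1"
    and even: "\<And>u v x. distinct [u, v, x] \<Longrightarrow> even (h u v + h v x + h u x)"
    and ex: "u \<noteq> v" "h u v \<noteq> 0"
  shows "(\<exists>w. triangle_pattern h w) \<or> (\<exists>x y. square_pattern h x y)"
proof -
  obtain x y where d: "distinct [u, v, x, y]" using four_extend2[OF ex(1)] .
  have uv: "h u v = 1" using le[of u v] ex by simp
  have s: "h v u = h u v" "h x u = h u x" "h y u = h u y" "h x v = h v x" "h y v = h v y" "h y x = h x y"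
    using d by (auto intro: sym)
  have "h p q = 0 \<or> h p q = 1" if "p \<noteq> q" for p q
    using le[OF that] by auto
  then have le': "h u x = 0 \<or> h u x = 1" "h u y = 0 \<or> h u y = 1" "h v x = 0 \<or> h v x = 1"
    "h v y = 0 \<or> h v y = 1" "h x y = 0 \<or> h x y = 1"
    using d by auto
  have ev: "even (h u v + h v x + h u x)" "even (h u v + h v y + h u y)"
    "even (h u x + h x y + h u y)" "even (h v x + h x y + h v y)"
    using d even[of u v x] even[of u v y] even[of u x y] even[of v x y] by auto
  note su = same_or_opposite_cases
  have c': "p = u \<and> q \<in> {v, x, y} \<or> p = v \<and> q \<in> {u, x, y} \<or> p = x \<and> q \<in> {u, v, y}
    \<or> p = y \<and> q \<in> {u, v, x}" if "p \<noteq> q" for p q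
    using that four_cases[OF d, of p] four_cases[OF d, of q] by auto
  \<comment> \<open>As \<open>uv\<close> is cut, parity on the faces lets \<open>h u x\<close> and
    \<open>h u y\<close> determine all other values. Equal values isolate \<open>u\<close> or
    \<open>v\<close>; different values leave \<open>u\<close> together with \<open>y\<close> or with
    \<open>x\<close>.\<close>
  consider "h u x = 1" "h u y = 1" | "h u x = 0" "h u y = 0" | "h u x = 1" "h u y = 0"
    | "h u x = 0" "h u y = 1"
    using le'(1,2) by (elim disjE) simp_all
  then show ?thesis
  proof cases
    case 1
    then have h0: "h v x = 0" "h v y = 0" "h x y = 0" using ev le' uv by auto
    have "triangle_pattern h u"
      unfolding triangle_pattern_def
      by (intro allI impI, drule c') (use 1 h0 uv s d in \<open>auto\<close>)
    then show ?thesis by blast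
  next
    case 2
    then have h0: "h v x = 1" "h v y = 1" "h x y = 0" using ev le' uv by auto
    have "triangle_pattern h v"
      unfolding triangle_pattern_def
      by (intro allI impI, drule c') (use 2 h0 uv s d in \<open>auto\<close>)
    then show ?thesis by blast
  next
    case 3
    then have h0: "h v x = 0" "h v y = 1" "h x y = 1" using ev le' uv by auto
    have "square_pattern h u y"
      unfolding square_pattern_def
      by (intro conjI allI impI, use d in simp, drule c') (use 3 h0 uv s d su[of u y v x] in \<open>auto\<close>)
    then show ?thesis by blast
  next
    case 4
    then have h0: "h v x = 1" "h v y = 0" "h x y = 1" using ev le' uv by auto
    have "square_pattern h u x"
      unfolding square_pattern_def
      by (intro conjI allI impI, use d in simp, drule c') (use 4 h0 uv s d su[of u x v y] in \<open>auto\<close>)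
    then show ?thesis by blast
  qed
qed


section \<open>The discs of a 2-normal surface\<close>

locale two_normal =
  fixes T :: "'a::finite gluing" and S :: "'a surface"
  assumes triangulation: "ideal_triangulation T" and two_normal: "two_normal_surface T S"
begin

lemma points_arcs: "distinct [f, u, v] \<Longrightarrow> points S t u v = arcs S t f u + arcs S t f v"
  using two_normal unfolding two_normal_surface_def by blast

lemma points_sym: "u \<noteq> v \<Longrightarrow> points S t u v = points S t v u"
proof (erule four_extend2)
  fix f x assume "distinct [u, v, f, x]"
  then show ?thesis using points_arcs[of f u v t] points_arcs[of f v u t] by auto
qed

lemma arcs_le_points: "distinct [f, u, v] \<Longrightarrow> arcs S t f u \<le> points S t u v"
  using points_arcs[of f u v t] by simp

lemma points_glue:
  assumes "u \<noteq> v" "f \<noteq> u" "f \<noteq> v"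
  shows "points S (nbr T t f) (perm T t f u) (perm T t f v) = points S t u v"
  using two_normal assms unfolding two_normal_surface_def by simp

lemma arcs_glue:
  "v \<noteq> f \<Longrightarrow> arcs S (nbr T t f) (perm T t f f) (perm T t f v) = arcs S t f v"
  using two_normal unfolding two_normal_surface_def by blast

lemma perm_eq_iff [simp]: "perm T t f u = perm T t f v \<longleftrightarrow> u = v"
  using triangulation unfolding ideal_triangulation_def by (metis bij_is_inj inj_eq)

lemma surface_points_iff [simp]: "(t, u, v, k) \<in> surface_points S \<longleftrightarrow> u \<noteq> v \<and> k < points S t u v"
  by (simp add: surface_points_def)

lemma surface_arcs_iff [simp]: "(t, f, v, k) \<in> surface_arcs S \<longleftrightarrow> v \<noteq> f \<and> k < arcs S t f v"
  by (simp add: surface_arcs_def)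

lemma finite_surface_points [simp]: "finite (surface_points S)"
proof (rule finite_subset)
  show "surface_points S \<subseteq> (\<Union>t. \<Union>u. \<Union>v. (\<lambda>k. (t, u, v, k)) ` {..<points S t u v})"
    by (auto simp: surface_points_def)
qed auto

lemma finite_surface_arcs [simp]: "finite (surface_arcs S)"
proof (rule finite_subset)
  show "surface_arcs S \<subseteq> (\<Union>t. \<Union>u. \<Union>v. (\<lambda>k. (t, u, v, k)) ` {..<arcs S t u v})"
    by (auto simp: surface_arcs_def)
qed auto

lemma flip_rel_points: "(p, q) \<in> flip_rel S \<Longrightarrow> p \<in> surface_points S \<and> q \<in> surface_points S"
  using points_sym by (fastforce simp: flip_rel_def)

lemma arc_rel_points:
  assumes "(p, q) \<in> arc_rel S"
  shows "p \<in> surface_points S \<and> q \<in> surface_points S"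
proof -
  from assms obtain t f v u x k where
    "p = (t, v, u, k)" "q = (t, v, x, k)" "distinct [f, v, u, x]" "(t, f, v, k) \<in> surface_arcs S"
    unfolding arc_rel_def by blast
  then have *: "p = (t, v, u, k)" "q = (t, v, x, k)" "distinct [f, v, u, x]" "k < arcs S t f v"
    by simp_all
  then have "arcs S t f v \<le> points S t v u" "arcs S t f v \<le> points S t v x"
    by (auto intro!: arcs_le_points)
  with * show ?thesis by auto
qed

lemma disc_rel_points:
  "(p, q) \<in> flip_rel S \<union> arc_rel S \<Longrightarrow> p \<in> surface_points S \<longleftrightarrow> q \<in> surface_points S"
  using flip_rel_points arc_rel_points by blast

lemma disc_subset: "c \<in> discs S \<Longrightarrow> c \<subseteq> surface_points S"
  unfolding discs_def by (rule equiv_gen_class_subset[OF disc_rel_points])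

lemma finite_discs: "finite (discs S)"
  unfolding discs_def by (rule finite_equiv_gen_classes) simp

lemma disc_of_point:
  assumes "p \<in> surface_points S"
  obtains c where "c \<in> discs S" "p \<in> c"
proof (rule that)
  show "equiv_gen (flip_rel S \<union> arc_rel S) `` {p} \<in> discs S"
    unfolding discs_def using assms by (rule quotientI)
qed simp

lemma disc_closed:
  assumes "c \<in> discs S" "(p, q) \<in> equiv_gen (flip_rel S \<union> arc_rel S)"
  shows "p \<in> c \<longleftrightarrow> q \<in> c"
  using assms unfolding discs_def by (auto elim!: quotientE intro: equiv_gen_trans equiv_gen_sym)

lemma disc_flip:
  assumes "c \<in> discs S" "(t, u, v, k) \<in> c"
  shows "(t, v, u, points S t u v - 1 - k) \<in> c"
proof -
  have "((t, u, v, k), (t, v, u, points S t u v - 1 - k)) \<in> flip_rel S"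
    using disc_subset[OF assms(1)] assms(2) by (auto simp: flip_rel_def)
  then show ?thesis
    using disc_closed[OF assms(1)] assms(2) by (meson UnI1 equiv_gen_base)
qed

lemma disc_arc:
  assumes "c \<in> discs S" "distinct [f, v, u, x]" "k < arcs S t f v"
  shows "(t, v, u, k) \<in> c \<longleftrightarrow> (t, v, x, k) \<in> c"
proof -
  have "((t, v, u, k), (t, v, x, k)) \<in> arc_rel S"
    using assms by (force simp: arc_rel_def)
  then show ?thesis
    using disc_closed[OF assms(1)] by (meson UnI2 equiv_gen_base)
qed

lemma disc_in_tetrahedron:
  assumes "c \<in> discs S"
  obtains t p where "p \<in> c" "\<And>p. p \<in> c \<Longrightarrow> fst p = t"
proof -
  from assms obtain p where p: "c = equiv_gen (flip_rel S \<union> arc_rel S) `` {p}"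
    by (auto simp: discs_def elim: quotientE)
  have "fst q = fst p" if "q \<in> c" for q
  proof -
    have "(p, q) \<in> equiv_gen (flip_rel S \<union> arc_rel S)" using that p by simp
    then have "fst p = fst q"
      by (rule equiv_gen_invariant) (auto simp: flip_rel_def arc_rel_def)
    then show ?thesis ..
  qed
  moreover have "p \<in> c" using p by simp
  ultimately show ?thesis using that by blast
qed

section \<open>Intersection numbers of a disc with the edges\<close>

lemma hits_eq:
  assumes "\<And>p. p \<in> c \<Longrightarrow> fst p = t"
  shows "hits c u v = card {k. (t, u, v, k) \<in> c}"
proof -
  have "{(t, k). (t, u, v, k) \<in> c} = Pair t ` {k. (t, u, v, k) \<in> c}"
  proof (intro equalityI subsetI)
    fix z assume "z \<in> {(t, k). (t, u, v, k) \<in> c}"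
    then obtain t' k where z: "z = (t', k)" "(t', u, v, k) \<in> c" by blast
    with assms[OF z(2)] show "z \<in> Pair t ` {k. (t, u, v, k) \<in> c}" by simp
  qed auto
  then show ?thesis unfolding hits_def by (simp add: card_image inj_on_def)
qed

text \<open>
  On the face \<open>f\<close> each point of the disc \<open>c\<close> on the edge \<open>uv\<close> is the end of an arc that cuts
  off either \<open>u\<close> or \<open>v\<close>.
\<close>

lemma hits_split:
  assumes c: "c \<in> discs S" "\<And>p. p \<in> c \<Longrightarrow> fst p = t" and d: "distinct [f, u, v]"
  shows "hits c u v = card {k. k < arcs S t f u \<and> (t, u, v, k) \<in> c}
    + card {k. k < arcs S t f v \<and> (t, v, u, k) \<in> c}"
proof -
  let ?N = "points S t u v"
  have N: "?N = arcs S t f u + arcs S t f v" "points S t v u = ?N"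
    using d points_arcs points_sym[of u v] by auto
  have lt: "k < ?N" if "(t, u, v, k) \<in> c \<or> (t, v, u, k) \<in> c" for k
    using that disc_subset[OF c(1)] N(2) by auto
  have fin: "finite {k. (t, u, v, k) \<in> c}" "finite {k. (t, v, u, k) \<in> c}"
    using lt by (auto intro: finite_subset[of _ "{..<?N}"])
  \<comment> \<open>Position \<open>k\<close> from \<open>u\<close> is position
    \<open>?N - 1 - k\<close> from \<open>v\<close>. As \<open>?N\<close> is the sum of the two arc
    numbers, the points beyond the arcs at \<open>u\<close> are the ends of the arcs at
    \<open>v\<close>.\<close>
  have "bij_betw (\<lambda>k. ?N - 1 - k) {k. arcs S t f u \<le> k \<and> (t, u, v, k) \<in> c}
      {k. k < arcs S t f v \<and> (t, v, u, k) \<in> c}"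
  proof (rule bij_betw_byWitness[where f' = "\<lambda>k. ?N - 1 - k"])
    show "(\<lambda>k. ?N - 1 - k) ` {k. arcs S t f u \<le> k \<and> (t, u, v, k) \<in> c}
        \<subseteq> {k. k < arcs S t f v \<and> (t, v, u, k) \<in> c}"
    proof clarify
      fix k assume k: "arcs S t f u \<le> k" "(t, u, v, k) \<in> c"
      with disc_flip[OF c(1) k(2)] lt[of k] N
      show "?N - 1 - k < arcs S t f v \<and> (t, v, u, ?N - 1 - k) \<in> c" by auto
    qed
    show "(\<lambda>k. ?N - 1 - k) ` {k. k < arcs S t f v \<and> (t, v, u, k) \<in> c}
        \<subseteq> {k. arcs S t f u \<le> k \<and> (t, u, v, k) \<in> c}"
    proof clarify
      fix k assume k: "k < arcs S t f v" "(t, v, u, k) \<in> c"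
      with disc_flip[OF c(1) k(2)] lt[of k] N
      show "arcs S t f u \<le> ?N - 1 - k \<and> (t, u, v, ?N - 1 - k) \<in> c" by auto
    qed
  qed (use lt in fastforce)+
  then have "card {k. arcs S t f u \<le> k \<and> (t, u, v, k) \<in> c}
      = card {k. k < arcs S t f v \<and> (t, v, u, k) \<in> c}"
    by (rule bij_betw_same_card)
  moreover have "hits c u v = card {k. (t, u, v, k) \<in> c}"
    using c(2) by (rule hits_eq)
  moreover have "{k. (t, u, v, k) \<in> c} = {k. k < arcs S t f u \<and> (t, u, v, k) \<in> c}
      \<union> {k. arcs S t f u \<le> k \<and> (t, u, v, k) \<in> c}"
    by auto
  moreover have "card \<dots> = card {k. k < arcs S t f u \<and> (t, u, v, k) \<in> c}
      + card {k. arcs S t f u \<le> k \<and> (t, u, v, k) \<in> c}"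
    by (rule card_Un_disjoint) (use fin in auto)
  ultimately show ?thesis by metis
qed

lemma hits_sym:
  assumes "c \<in> discs S" "u \<noteq> v"
  shows "hits c u v = hits c v u"
proof -
  obtain t where t: "\<And>p. p \<in> c \<Longrightarrow> fst p = t" using disc_in_tetrahedron[OF assms(1)] by blast
  obtain f x where "distinct [u, v, f, x]" using four_extend2[OF assms(2)] .
  then show ?thesis
    using hits_split[OF assms(1) t, of f u v] hits_split[OF assms(1) t, of f v u] by auto
qed

text \<open>In a face the disc traces arcs, and each of them has two ends on the three
  edges.\<close>

lemma hits_even:
  assumes "c \<in> discs S" "distinct [u, v, x]"
  shows "even (hits c u v + hits c v x + hits c u x)"
proof -
  obtain t where t: "\<And>p. p \<in> c \<Longrightarrow> fst p = t" using disc_in_tetrahedron[OF assms(1)] by blast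
  obtain f where d: "distinct [u, v, x, f]" using four_extend1[OF assms(2)] .
  \<comment> \<open>This counts the arcs of \<open>c\<close> that cut off \<open>p\<close> in face
    \<open>f\<close> through their ends on \<open>pq\<close>. Each has one end on either edge of the
    face at \<open>p\<close>, so both choices of \<open>q\<close> give the same number.\<close>
  define D where "D p q = card {k. k < arcs S t f p \<and> (t, p, q, k) \<in> c}" for p q
  have h: "hits c p q = D p q + D q p" if "distinct [f, p, q]" for p q
    unfolding D_def using hits_split[OF assms(1) t that] .
  have D: "D p q = D p r" if "distinct [f, p, q, r]" for p q r
    unfolding D_def
    by (intro arg_cong[where f = card] Collect_cong conj_cong refl) (rule disc_arc[OF assms(1) that])
  have "hits c u v + hits c v x + hits c u x
      = (D u v + D v u) + (D v x + D x v) + (D u x + D x u)"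
    using h[of u v] h[of v x] h[of u x] d by auto
  also have "\<dots> = 2 * (D u v + D v u + D x u)"
    using D[of u x v] D[of v x u] D[of x v u] d by auto
  finally show ?thesis by simp
qed

lemma hits_pos_iff:
  assumes c: "c \<in> discs S" "\<And>p. p \<in> c \<Longrightarrow> fst p = t"
  shows "hits c u v \<noteq> 0 \<longleftrightarrow> (\<exists>k. (t, u, v, k) \<in> c)"
proof -
  have "finite {k. (t, u, v, k) \<in> c}"
    using disc_subset[OF c(1)] by (auto intro!: finite_subset[of _ "{..<points S t u v}"])
  moreover have "hits c u v = card {k. (t, u, v, k) \<in> c}"
    using c(2) by (rule hits_eq)
  ultimately show ?thesis by auto
qed

text \<open>A disc contains a point, so the intersection numbers of a normal disc form a nonempty
  cut of the four vertices.\<close>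

lemma disc_cases:
  assumes c: "c \<in> discs S"
  obtains (triangle) w where "triangle_pattern (hits c) w"
  | (square) u v where "square_pattern (hits c) u v"
  | (octagon) "octagon c"
proof (cases "octagon c")
  case False
  with c have n: "normal_disc c" using two_normal by (auto simp: two_normal_surface_def)
  obtain t p where t: "p \<in> c" "\<And>p. p \<in> c \<Longrightarrow> fst p = t" using disc_in_tetrahedron[OF c] by blast
  obtain u v k where p: "p = (t, u, v, k)" using t(2)[OF t(1)] by (cases p) auto
  then have "u \<noteq> v" "hits c u v \<noteq> 0"
    using t(1) disc_subset[OF c] hits_pos_iff[OF c t(2)] by auto
  then have "(\<exists>w. triangle_pattern (hits c) w) \<or> (\<exists>x y. square_pattern (hits c) x y)"
    using n hits_sym[OF c] hits_even[OF c] by (intro even_pattern_cases) (auto simp: normal_disc_def)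
  then show ?thesis using that by blast
qed (use that in blast)

text \<open>A triangle around \<open>u\<close> leaves one arc at \<open>u\<close> in each of the
  three faces containing \<open>u\<close>; this is how a tetrahedron without squares and octagons
  looks on its boundary.\<close>

definition balanced :: "'a \<Rightarrow> bool" where
  "balanced t \<longleftrightarrow> (\<forall>u f g. f \<noteq> u \<and> g \<noteq> u \<longrightarrow> arcs S t f u = arcs S t g u)"

text \<open>If face \<open>g\<close> had more arcs at \<open>u\<close> than face \<open>f\<close>,
  take the point on \<open>uv\<close> of the first extra arc. Its curve runs through
  \<open>g\<close> to \<open>uf\<close> and through \<open>f\<close>, where it cuts off
  \<open>v\<close>, to \<open>vg\<close>. No vertex lies on all of \<open>uv\<close>,
  \<open>uf\<close> and \<open>vg\<close>.\<close>

lemma balancedI: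
  assumes tri: "\<And>c. c \<in> discs S \<Longrightarrow> (\<And>p. p \<in> c \<Longrightarrow> fst p = t) \<Longrightarrow> \<exists>w. triangle_pattern (hits c) w"
  shows "balanced t"
proof -
  have False if lt: "arcs S t f u < arcs S t g u" and ne: "f \<noteq> u" "g \<noteq> u" for f g u
  proof -
    have "f \<noteq> g" using lt by auto
    then have "distinct [f, g, u]" using ne by auto
    then obtain v where d: "distinct [f, g, u, v]" by (rule four_extend1)
    let ?k = "arcs S t f u" and ?N = "points S t u v"
    have N: "?N = arcs S t f u + arcs S t f v" "?N = arcs S t g u + arcs S t g v"
      using d points_arcs by auto
    then have "(t, u, v, ?k) \<in> surface_points S" using lt d by simp
    then obtain c where c: "c \<in> discs S" "(t, u, v, ?k) \<in> c" by (rule disc_of_point)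
    have t: "fst p = t" if "p \<in> c" for p
      using disc_in_tetrahedron[OF c(1)] that c(2) by (metis fst_conv)
    have 1: "(t, u, f, ?k) \<in> c" using disc_arc[OF c(1), of g u v f ?k t] d lt c(2) by auto
    have "(t, v, u, ?N - 1 - ?k) \<in> c" using disc_flip[OF c] .
    then have 2: "(t, v, g, ?N - 1 - ?k) \<in> c"
      using disc_arc[OF c(1), of f v u g "?N - 1 - ?k" t] d lt N by auto
    obtain w where "triangle_pattern (hits c) w" using tri[OF c(1) t] by blast
    moreover have "hits c u v \<noteq> 0" "hits c u f \<noteq> 0" "hits c v g \<noteq> 0"
      using hits_pos_iff[OF c(1) t] c(2) 1 2 by blast+
    ultimately show False
      using d four_cases[OF d, of w] unfolding triangle_pattern_def
      by (metis distinct_length_2_or_more insert_iff singletonD)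
  qed
  then show ?thesis unfolding balanced_def by (metis nat_neq_iff)
qed

text \<open>
  At its point on the edge \<open>ac\<close>, a square cuts off different ends of that edge in the two faces
  containing it.
\<close>

lemma square_not_balanced_at:
  assumes c: "c \<in> discs S" "\<And>p. p \<in> c \<Longrightarrow> fst p = t" "square_pattern (hits c) a d"
    and d: "distinct [a, b, c', d]"
  shows "arcs S t b a \<noteq> arcs S t d a"
proof -
  have h: "hits c a c' \<noteq> 0" "hits c a d = 0" "hits c c' b = 0"
    using c(3) d same_or_opposite_cases[of a d c' b] unfolding square_pattern_def by auto
  then obtain k where k: "(t, a, c', k) \<in> c" using hits_pos_iff[OF c(1,2)] by blast
  let ?N = "points S t a c'"
  \<comment> \<open>An arc at \<open>a\<close> in face \<open>b\<close> would lead to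
    \<open>ad\<close>, which the square misses. An arc at \<open>c'\<close> in face \<open>d\<close>
    would lead to the opposite edge \<open>c'b\<close>, missed as well.\<close>
  have "\<not> k < arcs S t b a"
    using disc_arc[OF c(1), of b a c' d k t] d k h(2) hits_pos_iff[OF c(1,2), of a d] by auto
  moreover have "k < arcs S t d a"
  proof (rule ccontr)
    assume "\<not> k < arcs S t d a"
    moreover have "?N = arcs S t d a + arcs S t d c'" using d points_arcs by auto
    moreover have "k < ?N" using k disc_subset[OF c(1)] by auto
    ultimately have "?N - 1 - k < arcs S t d c'" by auto
    then have "(t, c', b, ?N - 1 - k) \<in> c"
      using disc_arc[OF c(1), of d c' a b "?N - 1 - k" t] disc_flip[OF c(1) k] d by auto
    then show False using h(3) hits_pos_iff[OF c(1,2), of c' b] by auto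
  qed
  ultimately show ?thesis by auto
qed


section \<open>Combinatorial area\<close>

lemma edge_class_cong:
  "(t', x, y) \<in> edge_class T t u v \<Longrightarrow> edge_class T t' x y = edge_class T t u v"
  unfolding edge_class_def edge_rel_def
  by (auto intro: equiv_gen_trans equiv_gen_sym)

lemma edge_class_refl: "(t, u, v) \<in> edge_class T t u v"
  by (simp add: edge_class_def edge_rel_def)

lemma edge_class_invariant:
  assumes "(t', x, y) \<in> edge_class T t u v"
    and "\<And>t x y f. distinct [f, x, y] \<Longrightarrow>
      P t x y = P (nbr T t f) (perm T t f x) (perm T t f y)"
  shows "P t u v = P t' x y"
proof -
  have "((t, u, v), (t', x, y)) \<in> edge_rel T" using assms(1) by (simp add: edge_class_def)
  then have "(\<lambda>(t, x, y). P t x y) (t, u, v) = (\<lambda>(t, x, y). P t x y) (t', x, y)"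
    unfolding edge_rel_def
  proof (rule equiv_gen_invariant)
    fix e e' assume "(e, e') \<in> {((t, u, v), (nbr T t f, perm T t f u, perm T t f v)) | t u v f.
      u \<noteq> v \<and> f \<noteq> u \<and> f \<noteq> v}"
    then obtain t u v f where "e = (t, u, v)" "e' = (nbr T t f, perm T t f u, perm T t f v)"
      "u \<noteq> v" "f \<noteq> u" "f \<noteq> v" by blast
    with assms(2)[of f u v t]
    show "(case e of (t, x, y) \<Rightarrow> P t x y) = (case e' of (t, x, y) \<Rightarrow> P t x y)" by simp
  qed
  then show ?thesis by simp
qed

lemma edge_class_points:
  assumes "(t', x, y) \<in> edge_class T t u v" "u \<noteq> v"
  shows "x \<noteq> y" "points S t' x y = points S t u v"
proof -
  have "(u \<noteq> v) = (x \<noteq> y)"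
    by (rule edge_class_invariant[OF assms(1), where P = "\<lambda>t x y. x \<noteq> y"]) simp
  then show "x \<noteq> y" using assms(2) by simp
  show "points S t' x y = points S t u v"
    by (rule edge_class_invariant[OF assms(1), symmetric]) (simp add: points_glue)
qed

lemma edge_class_step:
  "distinct [f, u, v] \<Longrightarrow>
    edge_class T (nbr T t f) (perm T t f u) (perm T t f v) = edge_class T t u v"
  by (rule edge_class_cong)
    (force simp: edge_class_def edge_rel_def intro!: equiv_gen_base)

text \<open>Gluing carries both orientations of an edge along together, so membership of the
  reversed triple is constant on a class.\<close>

lemma edge_class_reverse:
  assumes "(t', x, y) \<in> edge_class T t v u"
  shows "(t', y, x) \<in> edge_class T t u v"
proof -
  have "((t, u, v) \<in> edge_class T t u v) = ((t', y, x) \<in> edge_class T t u v)"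
  proof (rule edge_class_invariant[OF assms, where P = "\<lambda>t' x y. (t', y, x) \<in> edge_class T t u v"])
    fix t' x y f assume "distinct [f :: 4, x, y]"
    then have *: "edge_class T (nbr T t' f) (perm T t' f y) (perm T t' f x) = edge_class T t' y x"
      by (intro edge_class_step) auto
    show "((t', y, x) \<in> edge_class T t u v)
        = ((nbr T t' f, perm T t' f y, perm T t' f x) \<in> edge_class T t u v)"
      using edge_class_cong[of t' y x t u v] * edge_class_refl
        edge_class_cong[of "nbr T t' f" "perm T t' f y" "perm T t' f x" t u v] by metis
  qed
  then show ?thesis using edge_class_refl by blast
qed

text \<open>The manifold condition, stated for the base triple, moves to every member of the class:
  each edge in it occurs with one orientation only.\<close>

lemma edge_class_not_reversed:
  "u \<noteq> v \<Longrightarrow> (t', x, y) \<in> edge_class T t u v \<Longrightarrow> (t', y, x) \<notin> edge_class T t u v"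
  using triangulation edge_class_cong edge_class_points(1)
  unfolding ideal_triangulation_def by metis

abbreviation vertex_rel where
  "vertex_rel \<equiv> flip_rel S \<union> glue_rel T S"

lemma vertex_rel_points:
  "(p, q) \<in> vertex_rel \<Longrightarrow> p \<in> surface_points S \<longleftrightarrow> q \<in> surface_points S"
  using flip_rel_points by (fastforce simp: glue_rel_def points_glue)

text \<open>
  A vertex of the cell structure of \<open>S\<close> is a point on an edge of \<open>T\<close>. It is represented by one
  point on each member of the edge class, counted from either end.
\<close>

lemma vertex_class:
  assumes uv: "u \<noteq> v" and k: "k < points S t u v"
  shows "equiv_gen vertex_rel `` {(t, u, v, k)} =
    (\<lambda>(t', x, y). (t', x, y, k)) ` edge_class T t u v \<union>
    (\<lambda>(t', x, y). (t', y, x, points S t u v - 1 - k)) ` edge_class T t u v"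
    (is "_ = ?A \<union> ?B")
proof
  let ?N = "points S t u v"
  \<comment> \<open>The edge class together with the position, read from both ends: flipping
    exchanges the two readings and gluing fixes them.\<close>
  let ?F = "\<lambda>(t, x, y, k). {(edge_class T t x y, k), (edge_class T t y x, points S t x y - 1 - k)}"
  show "equiv_gen vertex_rel `` {(t, u, v, k)} \<subseteq> ?A \<union> ?B"
  proof
    fix q assume q: "q \<in> equiv_gen vertex_rel `` {(t, u, v, k)}"
    obtain t' x y k' where q': "q = (t', x, y, k')" by (cases q)
    from q have "?F (t, u, v, k) = ?F q"
    proof (intro equiv_gen_invariant[of "(t, u, v, k)" q vertex_rel])
      fix p q assume "(p, q) \<in> vertex_rel"
      then show "?F p = ?F q"
      proof
        assume "(p, q) \<in> flip_rel S"
        then obtain t x y k where "p = (t, x, y, k)" "q = (t, y, x, points S t x y - 1 - k)"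
          "x \<noteq> y" "k < points S t x y"
          by (auto simp: flip_rel_def)
        then show ?thesis using points_sym[of x y t] by auto
      next
        assume "(p, q) \<in> glue_rel T S"
        then obtain t x y k f where p: "p = (t, x, y, k)"
          "q = (nbr T t f, perm T t f x, perm T t f y, k)" and d: "x \<noteq> y" "f \<noteq> x" "f \<noteq> y"
          by (auto simp: glue_rel_def)
        then show ?thesis
          using edge_class_step[of f x y t] edge_class_step[of f y x t] points_glue[OF d] by simp
      qed
    qed simp
    then have "(edge_class T t' x y, k') \<in> ?F (t, u, v, k)" using q' by auto
    then consider "edge_class T t' x y = edge_class T t u v" "k' = k"
      | "edge_class T t' x y = edge_class T t v u" "k' = ?N - 1 - k" by auto
    then show "q \<in> ?A \<union> ?B"
    proof cases
      case 1
      then have "(t', x, y) \<in> edge_class T t u v" using edge_class_refl by metis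
      then show ?thesis using 1 q' by force
    next
      case 2
      then have "(t', x, y) \<in> edge_class T t v u" using edge_class_refl by metis
      then have "(t', y, x) \<in> edge_class T t u v" by (rule edge_class_reverse)
      then show ?thesis using 2 q' by force
    qed
  qed
  have A: "((t, u, v, k), (t', x, y, k)) \<in> equiv_gen vertex_rel"
    if "(t', x, y) \<in> edge_class T t u v" for t' x y
  proof -
    \<comment> \<open>The bound on \<open>k\<close> is carried along because \<open>glue_rel\<close>
      relates points of \<open>S\<close> only.\<close>
    let ?P = "\<lambda>t' x y. x \<noteq> y \<and> k < points S t' x y \<and>
      ((t, u, v, k), (t', x, y, k)) \<in> equiv_gen vertex_rel"
    have "?P t u v = ?P t' x y"
    proof (rule edge_class_invariant[OF that, where P = ?P])
      fix t' x y f assume d: "distinct [f :: 4, x, y]"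
      have "((t', x, y, k), (nbr T t' f, perm T t' f x, perm T t' f y, k)) \<in> equiv_gen vertex_rel"
        if "x \<noteq> y" "k < points S t' x y"
        using that d by (intro equiv_gen_base UnI2) (auto simp: glue_rel_def)
      then show "?P t' x y = ?P (nbr T t' f) (perm T t' f x) (perm T t' f y)"
        using d points_glue[of x y f t'] by (auto intro: equiv_gen_trans equiv_gen_sym)
    qed
    then show ?thesis using uv k by auto
  qed
  have B: "((t, u, v, k), (t', y, x, ?N - 1 - k)) \<in> equiv_gen vertex_rel"
    if "(t', x, y) \<in> edge_class T t u v" for t' x y
  proof -
    have "((t', x, y, k), (t', y, x, ?N - 1 - k)) \<in> equiv_gen vertex_rel"
      using edge_class_points[OF that uv] k
      by (intro equiv_gen_base UnI1) (auto simp: flip_rel_def)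
    then show ?thesis using A[OF that] by (rule equiv_gen_trans[rotated])
  qed
  show "?A \<union> ?B \<subseteq> equiv_gen vertex_rel `` {(t, u, v, k)}"
    using A B by auto
qed

section \<open>Numbers of points and arcs\<close>

lemma surface_points_Sigma:
  "surface_points S = (SIGMA t:UNIV. SIGMA u:UNIV. SIGMA v:- {u}. {..<points S t u v})"
  by (auto simp: surface_points_def)

lemma surface_arcs_Sigma:
  "surface_arcs S = (SIGMA t:UNIV. SIGMA f:UNIV. SIGMA v:- {f}. {..<arcs S t f v})"
  by (auto simp: surface_arcs_def)

text \<open>Each point lies on one edge of its tetrahedron, counted from both ends, and on two arcs.\<close>

lemma card_surface_points: "card (surface_points S) = 2 * card (surface_arcs S)"
proof -
  have "(\<Sum>u\<in>UNIV. \<Sum>v\<in>- {u}. points S t u v) = 2 * (\<Sum>f\<in>UNIV. \<Sum>v\<in>- {f}. arcs S t f v)" for t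
  proof -
    obtain a b :: 4 where "a \<noteq> b" by (metis zero_neq_one)
    then obtain c d where d: "distinct [a, b, c, d]" by (rule four_extend2)
    \<comment> \<open>The two orientations of each edge are expanded in its two different faces, so
      every arc number occurs exactly twice.\<close>
    have "points S t a b = arcs S t c a + arcs S t c b" "points S t b a = arcs S t d b + arcs S t d a"
      "points S t a c = arcs S t b a + arcs S t b c" "points S t c a = arcs S t d c + arcs S t d a"
      "points S t a d = arcs S t b a + arcs S t b d" "points S t d a = arcs S t c d + arcs S t c a"
      "points S t b c = arcs S t a b + arcs S t a c" "points S t c b = arcs S t d c + arcs S t d b"
      "points S t b d = arcs S t a b + arcs S t a d" "points S t d b = arcs S t c d + arcs S t c b"
      "points S t c d = arcs S t a c + arcs S t a d" "points S t d c = arcs S t b d + arcs S t b c"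
      using d by (auto intro!: points_arcs)
    then show ?thesis unfolding sum_four_pairs[OF d] by simp
  qed
  then show ?thesis
    unfolding surface_points_Sigma surface_arcs_Sigma
    by (simp add: card_SigmaI sum_distrib_left)
qed

abbreviation glue_arc where
  "glue_arc \<equiv> \<lambda>(t, f, v, k). (nbr T t f, perm T t f f, perm T t f v, k)"

lemma nbr_nbr: "nbr T (nbr T t f) (perm T t f f) = t"
  using triangulation by (simp add: ideal_triangulation_def)

lemma perm_perm: "perm T (nbr T t f) (perm T t f f) (perm T t f v) = v"
  using triangulation by (simp add: ideal_triangulation_def bij_is_inj)

lemma face_not_self_glued: "nbr T t f = t \<Longrightarrow> perm T t f f \<noteq> f"
  using triangulation by (auto simp: ideal_triangulation_def)

text \<open>Gluing is an involution on the arcs, without fixed points because no face is glued to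
  itself. Its orbits are the edges of the cell structure of \<open>S\<close>.\<close>

lemma card_surface_arcs:
  "card (surface_arcs S) = 2 * card (surface_arcs S //
    equiv_gen {((t, f, v, k), (nbr T t f, perm T t f f, perm T t f v, k)) | t f v k.
           (t, f, v, k) \<in> surface_arcs S})"
proof -
  have "{((t, f, v, k), (nbr T t f, perm T t f f, perm T t f v, k)) | t f v k.
      (t, f, v, k) \<in> surface_arcs S} = {(p, glue_arc p) | p. p \<in> surface_arcs S}"
    by force
  moreover have "glue_arc p \<in> surface_arcs S \<and> glue_arc (glue_arc p) = p \<and> glue_arc p \<noteq> p"
    if "p \<in> surface_arcs S" for p
  proof -
    obtain t f v k where p: "p = (t, f, v, k)" by (cases p)
    with that arcs_glue[of v f t] face_not_self_glued[of t f] show ?thesis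
      by (auto simp: nbr_nbr perm_perm)
  qed
  ultimately show ?thesis using card_involution_classes[of "surface_arcs S" glue_arc] by simp
qed

lemma sum_over_disc:
  fixes g :: "'a \<Rightarrow> 4 \<Rightarrow> 4 \<Rightarrow> real"
  assumes c: "c \<in> discs S" "\<And>p. p \<in> c \<Longrightarrow> fst p = t"
  shows "(\<Sum>(t, u, v, k)\<in>c. g t u v) = (\<Sum>u\<in>UNIV. \<Sum>v\<in>- {u}. g t u v * real (hits c u v))"
proof -
  have "c = (SIGMA s:{t}. SIGMA u:UNIV. SIGMA v:- {u}. {k. (t, u, v, k) \<in> c})"
  proof (intro equalityI subsetI)
    fix p assume p: "p \<in> c"
    obtain t' u v k where p': "p = (t', u, v, k)" by (cases p)
    then have "t' = t" using c(2)[OF p] by simp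
    moreover have "u \<noteq> v" using p p' disc_subset[OF c(1)] by auto
    ultimately show "p \<in> (SIGMA s:{t}. SIGMA u:UNIV. SIGMA v:- {u}. {k. (t, u, v, k) \<in> c})"
      using p p' by simp
  qed auto
  moreover have fin: "finite {k. (t, u, v, k) \<in> c}" for u v
    using disc_subset[OF c(1)] by (auto intro!: finite_subset[of _ "{..<points S t u v}"])
  moreover have "(\<Sum>(t, u, v, k)\<in>(SIGMA s:{t}. SIGMA u:UNIV. SIGMA v:- {u}. {k. (t, u, v, k) \<in> c}).
      g t u v) = (\<Sum>u\<in>UNIV. \<Sum>v\<in>- {u}. \<Sum>k\<in>{k. (t, u, v, k) \<in> c}. g t u v)"
    using fin by (simp add: sum.Sigma[symmetric] finite_SigmaI)
  moreover have "hits c u v = card {k. (t, u, v, k) \<in> c}" for u v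
    using c(2) by (rule hits_eq)
  ultimately show ?thesis by (simp add: mult.commute)
qed

end

section \<open>Angles and areas of discs\<close>

locale angled = two_normal T S for T :: "'a::finite gluing" and S +
  fixes \<theta> :: "'a \<Rightarrow> 4 \<Rightarrow> 4 \<Rightarrow> real"
  assumes angled: "partially_flat_angled T \<theta>"
begin

lemma angle_sym: "u \<noteq> v \<Longrightarrow> \<theta> t u v = \<theta> t v u"
  and angle_nonneg: "u \<noteq> v \<Longrightarrow> 0 \<le> \<theta> t u v"
  and angle_le_pi: "u \<noteq> v \<Longrightarrow> \<theta> t u v \<le> pi"
  using angled unfolding partially_flat_angled_def by blast+

lemma angle_sum:
  assumes "distinct [u, v, x, y]"
  shows "\<theta> t u v + \<theta> t u x + \<theta> t u y \<le> pi"
proof -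
  have "\<forall>t u. (\<Sum>v\<in>- {u}. \<theta> t u v) \<le> pi"
    using angled unfolding partially_flat_angled_def by (elim conjE)
  then have "(\<Sum>v\<in>- {u}. \<theta> t u v) \<le> pi" by iprover
  moreover have "- {u} = {v, x, y}"
    using assms distinct_rev[of "[u, v, x, y]"]
    unfolding Compl_eq_Diff_UNIV four_UNIV[OF assms] by (simp add: insert_Diff_if)
  ultimately show ?thesis using assms by (simp add: add.assoc)
qed

lemma edge_angle_sum:
  assumes "u \<noteq> v"
  shows "(\<Sum>(t', x, y)\<in>edge_class T t u v. \<theta> t' x y) = 2 * pi"
proof -
  have "\<forall>t u v. u \<noteq> v \<longrightarrow> (\<Sum>(t', x, y)\<in>edge_class T t u v. \<theta> t' x y) = 2 * pi"
    using angled unfolding partially_flat_angled_def by (elim conjE)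
  with assms show ?thesis by iprover
qed

lemma positive_or_flat: "(\<forall>u v. u \<noteq> v \<longrightarrow> \<theta> t u v > 0) \<or> flat \<theta> t"
  using angled unfolding partially_flat_angled_def by blast

text \<open>The total is \<open>4 * pi\<close> and not \<open>2 * pi\<close> since a vertex is
  listed on each edge of its class from both ends. The two lists are disjoint as no edge is
  identified with its reverse.\<close>

lemma sum_vertex_class:
  assumes "c \<in> surface_points S // equiv_gen vertex_rel"
  shows "(\<Sum>(t, u, v, k)\<in>c. \<theta> t u v) = 4 * pi"
proof -
  from assms obtain t u v k where uv: "u \<noteq> v" and k: "k < points S t u v"
    and c: "c = equiv_gen vertex_rel `` {(t, u, v, k)}"
    by (auto elim!: quotientE)
  let ?E = "edge_class T t u v" and ?l = "points S t u v - 1 - k"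
  let ?A = "(\<lambda>(t', x, y). (t', x, y, k)) ` ?E" and ?B = "(\<lambda>(t', x, y). (t', y, x, ?l)) ` ?E"
  have "?A \<inter> ?B = {}" using edge_class_not_reversed[OF uv] by auto
  then have "(\<Sum>(t, u, v, k)\<in>?A \<union> ?B. \<theta> t u v)
      = (\<Sum>(t, u, v, k)\<in>?A. \<theta> t u v) + (\<Sum>(t, u, v, k)\<in>?B. \<theta> t u v)"
    by (intro sum.union_disjoint) auto
  also have "(\<Sum>(t, u, v, k)\<in>?A. \<theta> t u v) = (\<Sum>(t', x, y)\<in>?E. \<theta> t' x y)"
    by (subst sum.reindex) (auto simp: inj_on_def case_prod_beta)
  also have "(\<Sum>(t, u, v, k)\<in>?B. \<theta> t u v) = (\<Sum>(t', x, y)\<in>?E. \<theta> t' y x)"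
    by (subst sum.reindex) (auto simp: inj_on_def case_prod_beta)
  also have "\<dots> = (\<Sum>(t', x, y)\<in>?E. \<theta> t' x y)"
    by (rule sum.cong) (auto intro!: angle_sym dest: edge_class_points(1)[OF _ uv])
  finally show ?thesis
    using edge_angle_sum[OF uv] vertex_class[OF uv k] c by simp
qed

text \<open>The area of a hyperbolic polygon with the interior angles \<theta> at its corners.
  Halving corrects for each corner being listed from both ends.\<close>

definition area :: "'a point set \<Rightarrow> real" where
  "area c = (\<Sum>(t, u, v, k)\<in>c. pi - \<theta> t u v) / 2 - 2 * pi"

text \<open>Regrouped by vertices, the angles contribute \<open>4 * pi\<close> for each vertex of
  \<open>S\<close>, while the listed points number four times the edges of \<open>S\<close>. After
  halving, \<open>- 2 * pi\<close> times vertices minus edges plus discs remains.\<close>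

lemma gauss_bonnet: "(\<Sum>c\<in>discs S. area c) = - 2 * pi * of_int (euler_characteristic T S)"
proof -
  let ?V = "surface_points S // equiv_gen vertex_rel"
  have "(\<Sum>c\<in>?V. \<Sum>(t, u, v, k)\<in>c. \<theta> t u v) = (\<Sum>(t, u, v, k)\<in>surface_points S. \<theta> t u v)"
    by (rule sum_equiv_gen_classes[OF finite_surface_points vertex_rel_points])
  then have V: "(\<Sum>(t, u, v, k)\<in>surface_points S. \<theta> t u v) = 4 * pi * card ?V"
    using sum_vertex_class by (simp add: mult.commute)
  have "(\<Sum>c\<in>discs S. \<Sum>(t, u, v, k)\<in>c. pi - \<theta> t u v)
      = (\<Sum>(t, u, v, k)\<in>surface_points S. pi - \<theta> t u v)"
    unfolding discs_def by (rule sum_equiv_gen_classes[OF finite_surface_points disc_rel_points])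
  also have "\<dots> = pi * card (surface_points S) - (\<Sum>(t, u, v, k)\<in>surface_points S. \<theta> t u v)"
    by (simp add: case_prod_beta sum_subtractf)
  finally have "(\<Sum>c\<in>discs S. \<Sum>(t, u, v, k)\<in>c. pi - \<theta> t u v)
      = pi * card (surface_points S) - 4 * pi * card ?V"
    using V by simp
  then have "(\<Sum>c\<in>discs S. area c)
      = (pi * card (surface_points S) - 4 * pi * card ?V) / 2 - 2 * pi * card (discs S)"
    by (simp add: area_def sum_subtractf sum_divide_distrib[symmetric])
  then show ?thesis
    unfolding euler_characteristic_def card_surface_points
    by (subst (asm) card_surface_arcs) (simp add: field_simps)
qed

lemma area_eq:
  assumes c: "c \<in> discs S" "\<And>p. p \<in> c \<Longrightarrow> fst p = t" and d: "distinct [u, v, x, y]"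
  shows "area c = (pi - \<theta> t u v) * hits c u v + (pi - \<theta> t x y) * hits c x y
    + (pi - \<theta> t u x) * hits c u x + (pi - \<theta> t u y) * hits c u y
    + (pi - \<theta> t v x) * hits c v x + (pi - \<theta> t v y) * hits c v y - 2 * pi"
proof -
  have s: "(pi - \<theta> t p q) * hits c p q = (pi - \<theta> t q p) * hits c q p" if "p \<noteq> q" for p q
    using angle_sym[OF that] hits_sym[OF c(1) that] by simp
  have "(\<Sum>(t, u, v, k)\<in>c. pi - \<theta> t u v)
      = (\<Sum>u\<in>UNIV. \<Sum>v\<in>- {u}. (pi - \<theta> t u v) * hits c u v)"
    using sum_over_disc[OF c, where g = "\<lambda>t u v. pi - \<theta> t u v"] by simp
  then show ?thesis
    unfolding area_def sum_four_pairs[OF d]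
    using d s[of u v] s[of u x] s[of u y] s[of v x] s[of v y] s[of x y] by simp
qed

text \<open>The corners lie on the three edges at \<open>w\<close>, whose angles sum to at most
  \<open>pi\<close>.\<close>

lemma area_triangle:
  assumes c: "c \<in> discs S" and p: "triangle_pattern (hits c) w"
  shows "0 \<le> area c"
proof -
  obtain t where t: "\<And>p. p \<in> c \<Longrightarrow> fst p = t" using disc_in_tetrahedron[OF c] by blast
  obtain z :: 4 where "w \<noteq> z" by (metis zero_neq_one)
  then obtain x y where d: "distinct [w, z, x, y]" by (rule four_extend2)
  then have "hits c w z = 1" "hits c w x = 1" "hits c w y = 1"
    "hits c z x = 0" "hits c z y = 0" "hits c x y = 0"
    using p unfolding triangle_pattern_def by auto
  then show ?thesis using area_eq[OF c t d] angle_sum[OF d, of t] by simp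
qed

text \<open>The corners lie on the four edges joining \<open>u\<close> and \<open>v\<close> to the
  other two vertices. The angle sums at \<open>u\<close> and \<open>v\<close> bound these four
  angles by \<open>2 * pi - 2 * \<theta> t u v\<close>.\<close>

lemma area_square:
  assumes c: "c \<in> discs S" and t: "\<And>p. p \<in> c \<Longrightarrow> fst p = t" and p: "square_pattern (hits c) u v"
  shows "2 * \<theta> t u v \<le> area c"
proof -
  have uv: "u \<noteq> v" using p by (simp add: square_pattern_def)
  then obtain x y where d: "distinct [u, v, x, y]" by (rule four_extend2)
  then have "hits c u v = 0" "hits c x y = 0" "hits c u x = 1" "hits c u y = 1"
    "hits c v x = 1" "hits c v y = 1"
    using p same_or_opposite_cases[OF d] unfolding square_pattern_def by auto
  moreover have "distinct [v, u, x, y]" using d by auto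
  ultimately show ?thesis
    using area_eq[OF c t d] angle_sum[OF d, of t] angle_sum[of v u x y t] angle_sym[OF uv, of t]
    by simp
qed

text \<open>Compared with the square missing \<open>uv\<close> and \<open>xy\<close>, there are two
  more corners on each of these edges; they raise the bound to at least
  \<open>2 * pi\<close>.\<close>

lemma area_octagon:
  assumes c: "c \<in> discs S" and p: "octagon c"
  shows "0 < area c"
proof -
  obtain t where t: "\<And>p. p \<in> c \<Longrightarrow> fst p = t" using disc_in_tetrahedron[OF c] by blast
  from p obtain u v where uv: "u \<noteq> v"
    and h: "\<forall>x y. x \<noteq> y \<longrightarrow> hits c x y = (if same_or_opposite u v x y then 2 else 1)"
    unfolding octagon_def by blast
  obtain x y where d: "distinct [u, v, x, y]" using four_extend2[OF uv] .
  then have "hits c u v = 2" "hits c x y = 2" "hits c u x = 1" "hits c u y = 1"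
    "hits c v x = 1" "hits c v y = 1"
    using h same_or_opposite_cases[OF d] by auto
  moreover have "distinct [v, u, x, y]" "x \<noteq> y" using d by auto
  ultimately have "2 * pi \<le> area c"
    using area_eq[OF c t d] angle_sum[OF d, of t] angle_sum[of v u x y t] angle_sym[OF uv, of t]
      angle_le_pi[of x y t] by simp
  then show ?thesis using pi_gt_zero by linarith
qed

lemma area_nonneg:
  assumes c: "c \<in> discs S"
  shows "0 \<le> area c"
  using c
proof (cases rule: disc_cases)
  case (square u v)
  obtain t where t: "\<And>p. p \<in> c \<Longrightarrow> fst p = t" using disc_in_tetrahedron[OF c] by blast
  show ?thesis
    using area_square[OF c t square] angle_nonneg[of u v t] square by (simp add: square_pattern_def)
qed (use c in \<open>auto intro: area_triangle less_imp_le area_octagon\<close>)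

lemma euler_characteristic_nonpos: "euler_characteristic T S \<le> 0"
proof -
  have "0 \<le> (\<Sum>c\<in>discs S. area c)" by (rule sum_nonneg) (rule area_nonneg)
  then show ?thesis unfolding gauss_bonnet using pi_gt_zero by (simp add: mult_le_0_iff)
qed

lemma area_eq_0:
  assumes "euler_characteristic T S \<ge> 0" "c \<in> discs S"
  shows "area c = 0"
proof -
  have "euler_characteristic T S = 0" using assms(1) euler_characteristic_nonpos by simp
  then have "(\<Sum>c\<in>discs S. area c) = 0" by (simp add: gauss_bonnet)
  then show ?thesis using assms(2) finite_discs area_nonneg by (simp add: sum_nonneg_eq_0_iff)
qed

end


section \<open>Triangulated polygons\<close>

text \<open>The invariant carried through the moves; it forces the two diagonals of a move to
  cross.\<close>

definition noncrossing :: "nat set set \<Rightarrow> bool" where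
  "noncrossing E \<longleftrightarrow> (\<forall>p\<in>E. \<forall>q\<in>E. \<not> arcs_cross p q)"

lemma noncrossingD:
  "noncrossing E \<Longrightarrow> {i, j} \<in> E \<Longrightarrow> {k, l} \<in> E \<Longrightarrow> i < k \<Longrightarrow> k < j \<Longrightarrow> j < l \<Longrightarrow> False"
  unfolding noncrossing_def arcs_cross_def by blast

lemma arcs_cross_sym: "arcs_cross p q \<longleftrightarrow> arcs_cross q p"
  unfolding arcs_cross_def by blast

lemma arcs_cross_ordered:
  assumes "i < j" "k < l" "arcs_cross {i, j} {k, l}"
  shows "i < k \<and> k < j \<and> j < l \<or> k < i \<and> i < l \<and> l < j"
  using assms unfolding arcs_cross_def by (auto simp: doubleton_eq_iff)

lemma not_arcs_cross_self: "\<not> arcs_cross p p"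
  unfolding arcs_cross_def by (auto simp: doubleton_eq_iff)

text \<open>In every other order of the corners, two opposite sides of the square cross.\<close>

lemma square_diagonals_cross:
  assumes nc: "noncrossing E" and ap: "move_applicable E (a, b, c, d)" and "a < c" "b < d"
  shows "a < b \<and> b < c \<and> c < d \<or> b < a \<and> a < d \<and> d < c"
proof (rule ccontr)
  assume n: "\<not> ?thesis"
  have ne: "a \<noteq> b" "a \<noteq> d" "b \<noteq> c" "c \<noteq> d" using ap by auto
  have E: "{a, b} \<in> E" "{b, a} \<in> E" "{b, c} \<in> E" "{c, d} \<in> E" "{d, c} \<in> E" "{a, d} \<in> E"
    using ap by (auto simp: insert_commute)
  consider "a < c" "c < b" "b < d" | "a < b" "b < d" "d < c" | "b < d" "d < a" "a < c"
    | "b < a" "a < c" "c < d"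
    using n ne assms(3,4) by linarith
  then show False
    by cases (use noncrossingD[OF nc] E in blast)+
qed

text \<open>An arc crossing \<open>bd\<close> either is the other diagonal or crosses a side of the
  square, and the sides belong to \<open>E\<close>.\<close>

lemma arcs_cross_new_diagonal:
  assumes nc: "noncrossing E" and ap: "move_applicable E (a, b, c, d)" and "a < c" "b < d"
    and q: "{k, l} \<in> E" "k < l" "{k, l} \<noteq> {a, c}"
  shows "\<not> arcs_cross {b, d} {k, l}"
proof
  assume "arcs_cross {b, d} {k, l}"
  then have x: "b < k \<and> k < d \<and> d < l \<or> k < b \<and> b < l \<and> l < d"
    by (rule arcs_cross_ordered[OF assms(4) q(2)])
  have E: "{a, b} \<in> E" "{b, a} \<in> E" "{b, c} \<in> E" "{c, d} \<in> E" "{d, c} \<in> E" "{a, d} \<in> E"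
    using ap by (auto simp: insert_commute)
  note N = noncrossingD[OF nc _ q(1)] noncrossingD[OF nc q(1)]
  have ne: "\<not> (k = a \<and> l = c)" using q(3) by auto
  from square_diagonals_cross[OF nc ap assms(3,4)] x show False
  proof (elim disjE conjE)
    assume "a < b" "b < c" "c < d" "b < k" "k < d" "d < l"
    then show False using N E by (metis less_trans linorder_neqE_nat)
  next
    assume "a < b" "b < c" "c < d" "k < b" "b < l" "l < d"
    then show False using N E ne by (metis less_trans linorder_neqE_nat)
  next
    assume "b < a" "a < d" "d < c" "b < k" "k < d" "d < l"
    then show False using N E ne by (metis less_trans linorder_neqE_nat)
  next
    assume "b < a" "a < d" "d < c" "k < b" "b < l" "l < d"
    then show False using N E by (metis less_trans linorder_neqE_nat)
  qed
qed

text \<open>A square may be read from either end of each diagonal.\<close>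

lemma move_normalize:
  assumes "move_applicable E mv"
  obtains a b c d where "move_applicable E (a, b, c, d)" "a < c" "b < d"
    "removed mv = {a, c}" "inserted mv = {b, d}"
proof -
  obtain a b c d where mv: "mv = (a, b, c, d)" by (cases mv)
  have ne: "a \<noteq> c" "b \<noteq> d" using assms mv by auto
  have *: "move_applicable E (a', b', c', d')"
    if "(a', c') \<in> {(a, c), (c, a)}" "(b', d') \<in> {(b, d), (d, b)}" for a' b' c' d'
    using that assms mv by (auto simp: insert_commute)
  show ?thesis
    using that[of "min a c" "min b d" "max a c" "max b d"] *[of "min a c" "max a c" "min b d" "max b d"] ne
    by (auto simp: mv min_def max_def insert_commute)
qed

lemma removed_inserted_cross:
  assumes "noncrossing E" "move_applicable E mv"
  shows "arcs_cross (removed mv) (inserted mv)"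
proof -
  obtain a b c d where *: "move_applicable E (a, b, c, d)" "a < c" "b < d"
    "removed mv = {a, c}" "inserted mv = {b, d}"
    using move_normalize[OF assms(2)] .
  show ?thesis
    using square_diagonals_cross[OF assms(1) *(1-3)] unfolding *(4,5) arcs_cross_def by blast
qed

lemma noncrossing_move:
  assumes nc: "noncrossing E" and ap: "move_applicable E mv" and E: "E \<subseteq> polygon_arcs n"
  shows "noncrossing (insert (inserted mv) (E - {removed mv}))"
proof -
  obtain a b c d where *: "move_applicable E (a, b, c, d)" "a < c" "b < d"
    "removed mv = {a, c}" "inserted mv = {b, d}"
    using move_normalize[OF ap] .
  have "\<not> arcs_cross (inserted mv) q" if q: "q \<in> E - {removed mv}" for q
  proof -
    from q E obtain k l where "q = {k, l}" "k < l" unfolding polygon_arcs_def by blast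
    then show ?thesis using arcs_cross_new_diagonal[OF nc *(1-3), of k l] q *(4,5) by auto
  qed
  then show ?thesis
    using nc not_arcs_cross_self arcs_cross_sym unfolding noncrossing_def by blast
qed

text \<open>A crossing arc needs a corner on each side of \<open>e\<close>, but consecutive corners,
  \<open>n - 1\<close> and \<open>0\<close> included, have none on one side.\<close>

lemma side_not_crossed:
  assumes e: "e \<in> polygon_sides n" and q: "q \<in> polygon_arcs n"
  shows "\<not> arcs_cross e q"
proof
  assume x: "arcs_cross e q"
  from q obtain k l where q': "q = {k, l}" "k < l" "l < n" unfolding polygon_arcs_def by blast
  from e obtain i where i: "i < n" "e = {i, Suc i mod n}" unfolding polygon_sides_def by blast
  show False
  proof (cases "Suc i = n")
    case True
    then have "e = {0, i}" using i by auto
    moreover have "0 < i" using True q' by auto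
    ultimately show False using arcs_cross_ordered[of 0 i k l] x q' True by auto
  next
    case False
    then have "e = {i, Suc i}" using i by simp
    then show False using arcs_cross_ordered[of i "Suc i" k l] x q' by auto
  qed
qed

lemma inserted_polygon_arc:
  assumes "E \<subseteq> polygon_arcs n" "move_applicable E mv"
  shows "inserted mv \<in> polygon_arcs n"
proof -
  obtain a b c d where *: "move_applicable E (a, b, c, d)" "b < d" "inserted mv = {b, d}"
    using move_normalize[OF assms(2)] by metis
  then have "{d, a} \<in> polygon_arcs n" using assms(1) by auto
  then have "d < n" unfolding polygon_arcs_def by (auto simp: doubleton_eq_iff)
  then show ?thesis unfolding polygon_arcs_def using * by auto
qed

lemma stage_noncrossing:
  assumes P: "layered_polygon P" and k: "k \<le> length (moves P)"
  shows "noncrossing (stage P k) \<and> stage P k \<subseteq> polygon_arcs (nsides P)"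
  using k
proof (induction k)
  case 0
  then show ?case
    using P unfolding layered_polygon_def polygon_triangulation_def noncrossing_def by simp
next
  case (Suc k)
  then have ap: "move_applicable (stage P k) (moves P ! k)"
    using P unfolding layered_polygon_def by simp
  from Suc have IH: "noncrossing (stage P k)" "stage P k \<subseteq> polygon_arcs (nsides P)" by auto
  then show ?case
    using noncrossing_move[OF IH(1) ap IH(2)] inserted_polygon_arc[OF IH(2) ap] by auto
qed

text \<open>A removed arc crosses the arc inserted in its place, and nothing crosses a side. Hence
  the edge of a removed arc is never identified with an edge of another polygon.\<close>

lemma removed_not_side:
  assumes P: "layered_polygon P" and k: "k < length (moves P)"
  shows "removed (moves P ! k) \<notin> polygon_sides (nsides P)"
proof -
  have ap: "move_applicable (stage P k) (moves P ! k)"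
    using P k unfolding layered_polygon_def by simp
  have s: "noncrossing (stage P k)" "stage P k \<subseteq> polygon_arcs (nsides P)"
    using stage_noncrossing[OF P, of k] k by auto
  show ?thesis
    using removed_inserted_cross[OF s(1) ap] side_not_crossed inserted_polygon_arc[OF s(2) ap]
    by blast
qed


section \<open>Absence of squares\<close>

context two_normal
begin

text \<open>
  Counting arcs in the faces around an edge: gluing pairs up the faces without fixed points, and so
  does passing to the other face at the edge within a tetrahedron. If the number of arcs near the
  end \<open>a\<close> changes across no tetrahedron but \<open>t\<close>, then, by parity, it does not change across \<open>t\<close>.
\<close>

lemma arcs_unchanged_le:
  assumes d: "distinct [a, b, c, d]"
    and bal: "\<And>t' u v. (t', u, v) \<in> edge_class T t a c \<Longrightarrow> (t', u, v) \<noteq> (t, a, c) \<Longrightarrow> balanced t'"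
  shows "arcs S t b a \<le> arcs S t d a"
proof (rule ccontr)
  let ?E = "edge_class T t a c"
  define m where "m = arcs S t d a"
  assume "\<not> arcs S t b a \<le> arcs S t d a"
  then have m: "m < arcs S t b a" by (simp add: m_def)
  have ac: "a \<noteq> c" using d by simp
  \<comment> \<open>\<open>X\<close> lists the faces around the edge that have an arc number
    \<open>m\<close> at the end corresponding to \<open>a\<close>. \<open>G\<close> crosses a face
    into the next tetrahedron; \<open>W\<close> passes to the other face at the edge, opposite the
    fourth vertex \<open>h u v f\<close>.\<close>
  define X where "X = {(t', u, v, f). (t', u, v) \<in> ?E \<and> f \<noteq> u \<and> f \<noteq> v \<and> m < arcs S t' f u}"
  define G where "G = (\<lambda>(t', u, v, f). (nbr T t' f, perm T t' f u, perm T t' f v, perm T t' f f))"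
  define h where "h u v f = (SOME g :: 4. distinct [u, v, f, g])" for u v f :: 4
  define W where "W = (\<lambda>(t' :: 'a, u, v, f). (t', u, v, h u v f))"
  have h: "distinct [u, v, f, h u v f]" if uvf: "distinct [u, v, f]" for u v f
  proof -
    obtain g where "distinct [u, v, f, g]" using four_extend1[OF uvf] .
    then show ?thesis unfolding h_def by (rule someI)
  qed
  have hh: "h u v (h u v f) = f" if uvf: "distinct [u, v, f]" for u v f
  proof -
    have 1: "distinct [u, v, f, h u v f]" by (rule h[OF uvf])
    then have "distinct [u, v, h u v f, h u v (h u v f)]" by (intro h) auto
    then show ?thesis using four_cases[OF 1, of "h u v (h u v f)"] by auto
  qed
  have fin: "finite X" by simp
  have "even (card X)"
  proof (rule even_card_involution[OF fin])
    fix x assume x: "x \<in> X"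
    obtain t' u v f where x': "x = (t', u, v, f)" by (cases x)
    then have *: "(t', u, v) \<in> ?E" "f \<noteq> u" "f \<noteq> v" "m < arcs S t' f u"
      using x by (auto simp: X_def)
    then have "distinct [f, u, v]" using edge_class_points(1)[OF *(1) ac] by simp
    then have "(nbr T t' f, perm T t' f u, perm T t' f v) \<in> ?E"
      using edge_class_step[of f u v t'] edge_class_cong[OF *(1)] edge_class_refl by metis
    then have "G x \<in> X" unfolding X_def G_def x' using * arcs_glue[of u f t'] by simp
    moreover have "G (G x) = x" unfolding x' G_def by (simp add: nbr_nbr perm_perm)
    moreover have "G x \<noteq> x" unfolding x' G_def using face_not_self_glued[of t' f] by auto
    ultimately show "G x \<in> X \<and> G (G x) = x \<and> G x \<noteq> x" by blast
  qed
  \<comment> \<open>By the choice of \<open>m\<close>, face \<open>b\<close> of \<open>t\<close> is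
    in \<open>X\<close> and its partner \<open>d\<close> is not. Everywhere else balance keeps
    \<open>W\<close> inside \<open>X\<close>, so \<open>W\<close> acts once this single face is
    removed.\<close>
  moreover have "even (card (X - {(t, a, c, b)}))"
  proof (rule even_card_involution)
    fix x assume x: "x \<in> X - {(t, a, c, b)}"
    obtain t' u v f where x': "x = (t', u, v, f)" by (cases x)
    then have *: "(t', u, v) \<in> ?E" "f \<noteq> u" "f \<noteq> v" "m < arcs S t' f u"
      using x by (auto simp: X_def)
    have uvf: "distinct [u, v, f]" using * edge_class_points(1)[OF *(1) ac] by simp
    have ne: "(t', u, v) \<noteq> (t, a, c)"
    proof
      assume eq: "(t', u, v) = (t, a, c)"
      then have "f = d" using x x' * four_cases[OF d, of f] by auto
      then show False using *(4) eq by (simp add: m_def)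
    qed
    have g: "distinct [u, v, f, h u v f]" by (rule h[OF uvf])
    have "arcs S t' (h u v f) u = arcs S t' f u"
      using bal[OF *(1) ne] g unfolding balanced_def by (metis distinct_length_2_or_more)
    then have "W x \<in> X - {(t, a, c, b)}" unfolding X_def W_def x' using * g ne by auto
    moreover have "W (W x) = x" unfolding x' W_def by (simp add: hh[OF uvf])
    moreover have "W x \<noteq> x" unfolding x' W_def using g by auto
    ultimately show "W x \<in> X - {(t, a, c, b)} \<and> W (W x) = x \<and> W x \<noteq> x" by blast
  qed (use fin in simp)
  moreover have "(t, a, c, b) \<in> X"
    using d m edge_class_refl[of t a c] by (auto simp: X_def)
  ultimately show False using fin by (simp add: card_Diff_singleton card_gt_0_iff)
qed

lemma arcs_unchanged:
  assumes d: "distinct [a, b, c, d]"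
    and bal: "\<And>t' u v. (t', u, v) \<in> edge_class T t a c \<Longrightarrow> (t', u, v) \<noteq> (t, a, c) \<Longrightarrow> balanced t'"
  shows "arcs S t b a = arcs S t d a"
proof (rule antisym)
  show "arcs S t b a \<le> arcs S t d a" by (rule arcs_unchanged_le[OF d bal])
  have "distinct [a, d, c, b]" using d by auto
  then show "arcs S t d a \<le> arcs S t b a" by (rule arcs_unchanged_le[OF _ bal])
qed

text \<open>A square misses a pair of opposite edges, and one of the two contains
  \<open>a\<close>.\<close>

lemma square_pattern_cases:
  assumes p: "square_pattern h u v" and d: "distinct [a, b, c, d]"
  shows "square_pattern h a b \<or> square_pattern h a c \<or> square_pattern h a d"
proof -
  have uv: "u \<noteq> v" using p by (simp add: square_pattern_def)
  have swap: "square_pattern h x y \<longleftrightarrow> square_pattern h y x" for x y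
    unfolding square_pattern_def same_or_opposite_def by (simp add: insert_commute eq_commute)
  show ?thesis
  proof (cases "a = u \<or> a = v")
    case True
    then obtain w where "square_pattern h a w" using p swap by metis
    then show ?thesis using four_cases[OF d, of w] unfolding square_pattern_def by blast
  next
    case False
    then have "distinct [u, v, a]" using uv by auto
    then obtain w where w: "distinct [u, v, a, w]" by (rule four_extend1)
    have "same_or_opposite u v x y \<longleftrightarrow> same_or_opposite a w x y" if "x \<noteq> y" for x y
      using that w four_cases[OF w, of x] four_cases[OF w, of y]
        same_or_opposite_cases[of u v a w] same_or_opposite_cases[of a w u v]
      by auto
    then have "square_pattern h a w" using p w unfolding square_pattern_def by simp
    then show ?thesis using four_cases[OF d, of w] unfolding square_pattern_def by blast
  qed
qed

end

context angled
begin

text \<open>Squares and octagons would have positive area here, but all areas vanish.\<close>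

lemma balanced_of_positive:
  assumes chi: "euler_characteristic T S \<ge> 0" and pos: "\<forall>u v. u \<noteq> v \<longrightarrow> \<theta> t u v > 0"
  shows "balanced t"
proof (rule balancedI)
  fix c assume c: "c \<in> discs S" and t: "\<And>p. p \<in> c \<Longrightarrow> fst p = t"
  show "\<exists>w. triangle_pattern (hits c) w"
    using c
  proof (cases rule: disc_cases)
    case (square u v)
    then have "\<theta> t u v > 0" using pos by (simp add: square_pattern_def)
    then show ?thesis using area_square[OF c t square] area_eq_0[OF chi c] by simp
  next
    case octagon
    then show ?thesis using area_octagon[OF c] area_eq_0[OF chi c] by simp
  qed blast
qed

text \<open>A square missing \<open>ac\<close> would have area at least \<open>2 * pi\<close>. One
  missing \<open>ab\<close> or \<open>ad\<close> meets \<open>ac\<close> and makes the two arc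
  numbers at \<open>a\<close> differ.\<close>

lemma balanced_of_arcs_unchanged:
  assumes chi: "euler_characteristic T S \<ge> 0" and d: "distinct [a, b, c, d]"
    and angle: "\<theta> t a c = pi" and eq: "arcs S t b a = arcs S t d a"
  shows "balanced t"
proof (rule balancedI)
  fix e assume e: "e \<in> discs S" and t: "\<And>p. p \<in> e \<Longrightarrow> fst p = t"
  show "\<exists>w. triangle_pattern (hits e) w"
    using e
  proof (cases rule: disc_cases)
    case (square u v)
    have d': "distinct [a, d, c, b]" using d by auto
    from square_pattern_cases[OF square d] show ?thesis
    proof (elim disjE)
      assume "square_pattern (hits e) a b"
      from square_not_balanced_at[OF e t this d'] show ?thesis using eq by simp
    next
      assume "square_pattern (hits e) a c"
      from area_square[OF e t this] show ?thesis
        using area_eq_0[OF chi e] angle pi_gt_zero by simp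
    next
      assume "square_pattern (hits e) a d"
      from square_not_balanced_at[OF e t this d] show ?thesis using eq by simp
    qed
  next
    case octagon
    then show ?thesis using area_octagon[OF e] area_eq_0[OF chi e] by simp
  qed blast
qed

text \<open>Strong induction along the moves, applied at the edge removed by move \<open>i\<close>:
  every other member of its edge class lies in a tetrahedron that is not flat or belongs to an
  earlier move.\<close>

lemma balanced_flat:
  assumes chi: "euler_characteristic T S \<ge> 0"
    and lay: "layered_by T \<theta> Ps pos lab"
    and j: "j < length Ps" and i: "i < length (moves (Ps ! j))"
  shows "balanced (pos j i)"
  using i
proof (induction i rule: less_induct)
  case (less i)
  define I where "I = {(j, i). j < length Ps \<and> i < length (moves (Ps ! j))}"
  have L: "\<forall>P\<in>set Ps. layered_polygon P"
    "bij_betw (\<lambda>(j, i). pos j i) I {t. flat \<theta> t}"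
    "\<forall>(j, i)\<in>I. bij_betw (lab j i) UNIV (corners (moves (Ps ! j) ! i))"
    "\<forall>(j, i)\<in>I. \<forall>u v. u \<noteq> v \<longrightarrow>
        \<theta> (pos j i) u v =
          (if lab j i ` {u, v} \<in> {removed (moves (Ps ! j) ! i), inserted (moves (Ps ! j) ! i)}
           then pi else 0)"
    "\<forall>(j, i)\<in>I. \<forall>(j', i')\<in>I. \<forall>u v u' v'.
        u \<noteq> v \<and> u' \<noteq> v' \<and> (pos j' i', u', v') \<in> edge_class T (pos j i) u v \<longrightarrow>
        lab j i ` {u, v} \<in> polygon_sides (nsides (Ps ! j)) \<and>
          lab j' i' ` {u', v'} \<in> polygon_sides (nsides (Ps ! j')) \<or>
        j = j' \<and> lab j i ` {u, v} = lab j i' ` {u', v'} \<and>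
          same_edge_in (Ps ! j) i i' (lab j i ` {u, v})"
    using lay unfolding layered_by_def Let_def I_def by - (elim conjE, assumption)+
  have ji: "(j, i) \<in> I" using j less.prems by (simp add: I_def)
  let ?P = "Ps ! j" and ?t = "pos j i"
  let ?m = "moves ?P ! i"
  have P: "layered_polygon ?P" using L(1) j by simp
  have ap: "move_applicable (stage ?P i) ?m"
    using P less.prems unfolding layered_polygon_def by simp
  obtain a0 b0 c0 d0 where m: "?m = (a0, b0, c0, d0)" by (cases ?m)
  have ac0: "a0 \<noteq> c0" using ap m by simp
  have bij: "bij_betw (lab j i) UNIV (corners ?m)" using L(3) ji by auto
  have "a0 \<in> lab j i ` UNIV" "c0 \<in> lab j i ` UNIV"
    using bij_betw_imp_surj_on[OF bij] m by auto
  then obtain a c where ac: "a0 = lab j i a" "c0 = lab j i c" by blast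
  then have "a \<noteq> c" using ac0 by auto
  then obtain b d where "distinct [a, c, b, d]" by (rule four_extend2)
  then have d: "distinct [a, b, c, d]" by auto
  have rem: "lab j i ` {a, c} = removed ?m" using m ac by simp
  have "\<theta> ?t a c = pi" using L(4) ji \<open>a \<noteq> c\<close> rem by fastforce
  moreover have "arcs S ?t b a = arcs S ?t d a"
  proof (rule arcs_unchanged[OF d])
    fix t' u v assume e: "(t', u, v) \<in> edge_class T ?t a c" "(t', u, v) \<noteq> (?t, a, c)"
    show "balanced t'"
    proof (cases "flat \<theta> t'")
      case False
      then show ?thesis using positive_or_flat[of t'] balanced_of_positive[OF chi, of t'] by blast
    next
      case True
      then have "t' \<in> (\<lambda>(j, i). pos j i) ` I" using bij_betw_imp_surj_on[OF L(2)] by simp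
      then obtain j' i' where ji': "(j', i') \<in> I" "t' = pos j' i'" by auto
      have "u \<noteq> v" using edge_class_points(1)[OF e(1) \<open>a \<noteq> c\<close>] .
      \<comment> \<open>The alternative in \<open>layered_by\<close>, that both edges are sides,
        fails for a removed arc.\<close>
      then have "j = j' \<and> lab j i ` {a, c} = lab j i' ` {u, v} \<and>
          same_edge_in ?P i i' (lab j i ` {a, c})"
        using L(5)[THEN bspec, OF ji, unfolded prod.case, THEN bspec, OF ji'(1), unfolded prod.case,
            THEN spec[of _ a], THEN spec[of _ c], THEN spec[of _ u], THEN spec[of _ v]]
          e(1) ji'(2) \<open>a \<noteq> c\<close> removed_not_side[OF P less.prems] rem by metis
      then have *: "j' = j" "lab j i ` {a, c} = lab j i' ` {u, v}" "same_edge_in ?P i i' (removed ?m)"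
        using rem by auto
      \<comment> \<open>Move \<open>i\<close> itself removes the arc, so a later tetrahedron cannot
        contain the same edge.\<close>
      have "\<not> i < i'" using *(3) unfolding same_edge_in_def by auto
      \<comment> \<open>In \<open>?t\<close> only the edge \<open>ac\<close> carries this arc, and
        its reverse is not in the class.\<close>
      moreover have "i' \<noteq> i"
      proof
        assume "i' = i"
        then have "{a, c} = {u, v}"
          using *(2) inj_image_eq_iff[OF bij_betw_imp_inj_on[OF bij], of "{a, c}" "{u, v}"] by blast
        moreover have "t' = ?t" using ji'(2) *(1) \<open>i' = i\<close> by simp
        ultimately have "(t', u, v) = (?t, c, a)" using e(2) by (auto simp: doubleton_eq_iff)
        then show False
          using edge_class_not_reversed[OF \<open>a \<noteq> c\<close> edge_class_refl] e(1) by simp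
      qed
      ultimately have "i' < i" by simp
      then have "balanced (pos j i')" using less.IH ji'(1) *(1) by (simp add: I_def)
      then show ?thesis using ji'(2) *(1) by simp
    qed
  qed
  ultimately show ?case using balanced_of_arcs_unchanged[OF chi d] by blast
qed

lemma balanced_all:
  assumes chi: "euler_characteristic T S \<ge> 0"
  shows "balanced t"
proof (cases "flat \<theta> t")
  case False
  then show ?thesis using positive_or_flat[of t] balanced_of_positive[OF chi, of t] by blast
next
  case True
  obtain Ps pos lab where lay: "layered_by T \<theta> Ps pos lab"
    using angled unfolding partially_flat_angled_def by (elim conjE exE)
  then have "bij_betw (\<lambda>(j, i). pos j i) {(j, i). j < length Ps \<and> i < length (moves (Ps ! j))}
      {t. flat \<theta> t}"
    unfolding layered_by_def Let_def by (elim conjE)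
  with True have "t \<in> (\<lambda>(j, i). pos j i) ` {(j, i). j < length Ps \<and> i < length (moves (Ps ! j))}"
    by (simp add: bij_betw_def)
  then obtain j i where "j < length Ps" "i < length (moves (Ps ! j))" "t = pos j i" by auto
  then show ?thesis using balanced_flat[OF chi lay] by simp
qed

end


section \<open>Vertex links\<close>

text \<open>The records may differ at the arguments \<open>u = v\<close> or \<open>v = f\<close>,
  which stand for no edge or arc; the points, arcs and relations built from them coincide.\<close>

lemma normally_isotopic_cong:
  assumes "normally_isotopic S S'"
  shows "connected_surface T S' = connected_surface T S"
    and "euler_characteristic T S' = euler_characteristic T S"
proof -
  have p: "points S t u v = points S' t u v" if "u \<noteq> v" for t u v
    using assms that unfolding normally_isotopic_def by blast
  have a: "arcs S t f v = arcs S' t f v" if "v \<noteq> f" for t f v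
    using assms that unfolding normally_isotopic_def by blast
  have SP: "surface_points S' = surface_points S"
    unfolding surface_points_def using p by auto
  have SA: "surface_arcs S' = surface_arcs S"
    unfolding surface_arcs_def using a by auto
  have F: "flip_rel S' = flip_rel S"
  proof -
    have "flip_rel S' = {((t, u, v, k), (t, v, u, points S t u v - 1 - k)) | t u v k.
       (t, u, v, k) \<in> surface_points S}"
      unfolding flip_rel_def SP
      by (intro Collect_cong ex_cong1) (auto simp: surface_points_def p)
    then show ?thesis by (simp add: flip_rel_def)
  qed
  have G: "glue_rel T S' = glue_rel T S" by (simp add: glue_rel_def SP)
  have A: "arc_rel S' = arc_rel S" by (simp add: arc_rel_def SA)
  show "connected_surface T S' = connected_surface T S"
    by (simp only: connected_surface_def SP F G A)
  show "euler_characteristic T S' = euler_characteristic T S"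
    by (simp only: euler_characteristic_def discs_def SP SA F G A)
qed

text \<open>\<open>\<sigma> f v u x\<close> is the sense of the ordering \<open>f, v, u, x\<close> of the vertices of a tetrahedron.\<close>

lemma four_sense:
  obtains \<sigma> :: "4 \<Rightarrow> 4 \<Rightarrow> 4 \<Rightarrow> 4 \<Rightarrow> int" where
    "\<And>f v u x. \<sigma> f v u x = 1 \<or> \<sigma> f v u x = - 1"
    "\<And>f v u x. distinct [f, v, u, x] \<Longrightarrow> \<sigma> f v x u = - \<sigma> f v u x"
    "\<And>f v u x. distinct [f, v, u, x] \<Longrightarrow> \<sigma> x v u f = - \<sigma> f v u x"
    "\<And>\<pi> f v u x. bij \<pi> \<Longrightarrow> distinct [f, v, u, x] \<Longrightarrow>
      \<sigma> (\<pi> f) (\<pi> v) (\<pi> u) (\<pi> x) = sign \<pi> * \<sigma> f v u x"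
proof -
  obtain a b :: 4 where "a \<noteq> b" by (metis zero_neq_one)
  then obtain c d where d: "distinct [a, b, c, d]" by (rule four_extend2)
  \<comment> \<open>For distinct arguments, the permutation taking the reference ordering
    \<open>a, b, c, d\<close> to \<open>f, v, u, x\<close>; its sign is the sense.\<close>
  define q where "q f v u x = (\<lambda>z. if z = a then f else if z = b then v else if z = c then u else x)"
    for f v u x :: 4
  have perm: "permutation p" if "bij p" for p :: "4 \<Rightarrow> 4"
    using that by (simp add: permutation)
  have q: "permutation (q f v u x)" if uvf: "distinct [f, v, u, x]" for f v u x
  proof (intro perm)
    have "inj (q f v u x)"
    proof (rule injI)
      fix y z assume "q f v u x y = q f v u x z"
      then show "y = z"
        using uvf four_cases[OF d, of y] four_cases[OF d, of z] d by (auto simp: q_def split: if_splits)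
    qed
    then show "bij (q f v u x)" by (simp add: bij_def finite_UNIV_inj_surj)
  qed
  have swap: "sign (p \<circ> Transposition.transpose y z) = - sign p" if "permutation p" "y \<noteq> z" for p and y z :: 4
    using that by (simp add: sign_compose permutation_swap_id sign_swap_id)
  show thesis
  proof (rule that[of "\<lambda>f v u x. sign (q f v u x)"])
    show "sign (q f v u x) = 1 \<or> sign (q f v u x) = - 1" for f v u x
      by (simp add: sign_def)
  next
    fix f v u x :: 4 assume 1: "distinct [f, v, u, x]"
    have "q f v x u = q f v u x \<circ> Transposition.transpose c d"
      using d four_cases[OF d] by (auto simp: fun_eq_iff q_def Transposition.transpose_def)
    then show "sign (q f v x u) = - sign (q f v u x)" using swap[OF q[OF 1], of c d] d by simp
    have "q x v u f = q f v u x \<circ> Transposition.transpose a d"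
      using d four_cases[OF d] by (auto simp: fun_eq_iff q_def Transposition.transpose_def)
    then show "sign (q x v u f) = - sign (q f v u x)" using swap[OF q[OF 1], of a d] d by simp
    fix \<pi> :: "4 \<Rightarrow> 4" assume 2: "bij \<pi>"
    have "q (\<pi> f) (\<pi> v) (\<pi> u) (\<pi> x) = \<pi> \<circ> q f v u x"
      by (auto simp: fun_eq_iff q_def)
    then show "sign (q (\<pi> f) (\<pi> v) (\<pi> u) (\<pi> x)) = sign \<pi> * sign (q f v u x)"
      by (simp add: sign_compose perm[OF 2] q[OF 1])
  qed
qed

text \<open>An arc is positive iff the sense of \<open>f, v, u, x\<close> agrees with
  \<open>\<epsilon> t\<close>. Reversing the arc swaps \<open>u\<close> and \<open>x\<close>;
  turning to the other arc at a point swaps \<open>f\<close> and \<open>x\<close>. Across a face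
  exactly one of the sense and \<epsilon> changes.\<close>

lemma orientable_link:
  fixes T :: "'a gluing"
  assumes tri: "ideal_triangulation T" and or: "orientable T"
  shows "orientable_surface T (link B)"
proof -
  obtain \<epsilon> :: "'a \<Rightarrow> bool" where \<epsilon>:
    "\<And>t f. sign (perm T t f) = (if \<epsilon> (nbr T t f) = \<epsilon> t then - 1 else 1)"
    using or unfolding orientable_def by blast
  have bij: "bij (perm T t f)" for t f
    using tri unfolding ideal_triangulation_def by blast
  obtain \<sigma> :: "4 \<Rightarrow> 4 \<Rightarrow> 4 \<Rightarrow> 4 \<Rightarrow> int" where \<sigma>:
    "\<And>f v u x. \<sigma> f v u x = 1 \<or> \<sigma> f v u x = - 1"
    "\<And>f v u x. distinct [f, v, u, x] \<Longrightarrow> \<sigma> f v x u = - \<sigma> f v u x"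
    "\<And>f v u x. distinct [f, v, u, x] \<Longrightarrow> \<sigma> x v u f = - \<sigma> f v u x"
    "\<And>\<pi> f v u x. bij \<pi> \<Longrightarrow> distinct [f, v, u, x] \<Longrightarrow>
      \<sigma> (\<pi> f) (\<pi> v) (\<pi> u) (\<pi> x) = sign \<pi> * \<sigma> f v u x"
    by (rule four_sense) blast
  define D where "D = {(t, f, v, u, k :: nat) | t f v u k.
    \<exists>x. distinct [f, v, u, x] \<and> (\<sigma> f v u x = 1) = \<epsilon> t}"
  have D: "(t, f, v, u, k) \<in> D \<longleftrightarrow> (\<sigma> f v u x = 1) = \<epsilon> t" if d: "distinct [f, v, u, x]"
    for t f v u x k
  proof -
    have "y = x" if "distinct [f, v, u, y]" for y
      using that four_cases[OF d, of y] by auto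
    with d show ?thesis unfolding D_def by blast
  qed
  have one: "(- s = 1) = (s \<noteq> 1)" if "s = 1 \<or> s = - 1" for s :: int using that by auto
  show ?thesis
    unfolding orientable_surface_def
  proof (intro exI[of _ D] conjI allI impI; elim conjE)
    fix t :: 'a and f v u x :: 4 and k :: nat
    assume d: "distinct [f, v, u, x]"
    then have d': "distinct [f, v, x, u]" by auto
    show "((t, f, v, u, k) \<in> D) = ((t, f, v, x, k) \<notin> D)"
      unfolding D[OF d] D[OF d'] \<sigma>(2)[OF d] one[OF \<sigma>(1)] by blast
    let ?p = "perm T t f"
    have d'': "distinct [?p f, ?p v, ?p u, ?p x]"
      using d bij_is_inj[OF bij, of t f] by (auto dest: injD)
    show "((t, f, v, u, k) \<in> D) = ((nbr T t f, ?p f, ?p v, ?p u, k) \<notin> D)"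
      unfolding D[OF d] D[OF d''] \<sigma>(4)[OF bij d] \<epsilon> using one[OF \<sigma>(1)] by auto
  next
    fix t :: 'a and f g v u v' u' :: 4 and k k' :: nat
    assume dist: "distinct [f, v, u]" "distinct [g, v', u']" "f \<noteq> g"
      and "(t, f, v, k) \<in> surface_arcs (link B)" "(t, g, v', k') \<in> surface_arcs (link B)"
      and flip: "((t, v, u, k), (t, v', u', k')) \<in> (flip_rel (link B))\<^sup>="
    then have B: "(t, v) \<in> B" "k = 0" "(t, v') \<in> B" "k' = 0"
      unfolding surface_arcs_def link_def by (auto split: if_splits simp: of_bool_def)
    \<comment> \<open>A flip would need both ends of the edge in \<open>B\<close>; then there are
      two points on it, and position \<open>0\<close> flips to \<open>1\<close>, not to
      \<open>0\<close>.\<close>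
    have "v' = v \<and> u' = u"
    proof (rule ccontr)
      assume "\<not> ?thesis"
      with flip have "v' = u" "k' = points (link B) t v u - 1 - k" by (auto simp: flip_rel_def)
      with B show False by (simp add: link_def)
    qed
    then have d: "distinct [f, v, u, g]" and d': "distinct [g, v, u, f]"
      and eq: "v' = v" "u' = u" using dist by auto
    show "((t, f, v, u, k) \<in> D) = ((t, g, v', u', k') \<notin> D)"
      unfolding eq D[OF d] D[OF d'] \<sigma>(3)[OF d] one[OF \<sigma>(1)] by blast
  qed
qed

context two_normal
begin

text \<open>
  A surface made of triangles only is a union of copies of vertex links. The label \<open>(B, k)\<close> of a
  point tells that it lies on the \<open>k\<close>-th copy of the link of \<open>B\<close>.
\<close>

lemma parallel_to_link:
  assumes bal: "\<And>t. balanced t" and con: "connected_surface T S"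
  obtains B where "B \<in> boundary_components T" "normally_parallel S B"
proof -
  \<comment> \<open>The number of triangles around \<open>v\<close>; by balance any face at
    \<open>v\<close> yields it.\<close>
  define w where "w t v = arcs S t (SOME f. f \<noteq> v) v" for t v
  have w: "arcs S t f v = w t v" if "f \<noteq> v" for t f v
  proof -
    have "(SOME f. f \<noteq> v) \<noteq> v" using that by (rule someI)
    then show ?thesis using bal[of t] that unfolding balanced_def w_def by blast
  qed
  have pw: "points S t u v = w t u + w t v" if uv: "u \<noteq> v" for t u v
  proof -
    obtain f x where "distinct [u, v, f, x]" using four_extend2[OF uv] .
    then show ?thesis using points_arcs[of f u v t] w[of f u t] w[of f v t] by auto
  qed
  let ?r = "{((t, v), (nbr T t f, perm T t f v)) | t v f. f \<noteq> v}"
  define cls where "cls z = equiv_gen ?r `` {z}" for z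
  have cls_refl: "z \<in> cls z" for z by (simp add: cls_def)
  have cls_eq: "cls y = cls z" if "y \<in> cls z" for y z
    using that unfolding cls_def by (auto intro: equiv_gen_trans equiv_gen_sym)
  have wg: "w (nbr T t f) (perm T t f v) = w t v" if "f \<noteq> v" for t f v
    using arcs_glue[of v f t] w[of f v t] w[of "perm T t f f" "perm T t f v" "nbr T t f"] that by auto
  have cls_glue: "cls (nbr T t f, perm T t f v) = cls (t, v)" if "f \<noteq> v" for t f v
    by (rule cls_eq) (use that in \<open>auto simp: cls_def intro!: equiv_gen_base\<close>)
  have w_cls: "w t v = w t' v'" if "(t', v') \<in> cls (t, v)" for t v t' v'
  proof -
    have "((t, v), (t', v')) \<in> equiv_gen ?r" using that by (simp add: cls_def)
    then have "case_prod w (t, v) = case_prod w (t', v')"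
      by (rule equiv_gen_invariant) (use wg in auto)
    then show ?thesis by simp
  qed
  \<comment> \<open>The first \<open>w t u\<close> points counted from \<open>u\<close> lie on
    triangles around \<open>u\<close>. The others lie on triangles around \<open>v\<close> and get
    their level from that end.\<close>
  define L where "L = (\<lambda>(t, u, v, k). if k < w t u then (cls (t, u), k)
    else (cls (t, v), points S t u v - 1 - k))"
  have L: "L p = L q" if pq: "(p, q) \<in> flip_rel S \<union> glue_rel T S \<union> arc_rel S" for p q
  proof -
    from pq consider "(p, q) \<in> flip_rel S" | "(p, q) \<in> glue_rel T S" | "(p, q) \<in> arc_rel S" by blast
    then show ?thesis
    proof cases
      case 1
      then obtain t u v k where *: "p = (t, u, v, k)" "q = (t, v, u, points S t u v - 1 - k)"
        "u \<noteq> v" "k < points S t u v"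
        by (auto simp: flip_rel_def)
      then show ?thesis using pw[of u v t] pw[of v u t] by (auto simp: L_def)
    next
      case 2
      then obtain t u v k f where *: "p = (t, u, v, k)"
        "q = (nbr T t f, perm T t f u, perm T t f v, k)" "u \<noteq> v" "f \<noteq> u" "f \<noteq> v"
        by (auto simp: glue_rel_def)
      then show ?thesis
        using wg[of f u t] cls_glue[of f u t] cls_glue[of f v t] points_glue[of u v f t]
        by (simp add: L_def)
    next
      case 3
      then obtain t f v u x k where "p = (t, v, u, k)" "q = (t, v, x, k)"
        "distinct [f, v, u, x]" "(t, f, v, k) \<in> surface_arcs S"
        unfolding arc_rel_def by blast
      then show ?thesis using w[of f v t] by (auto simp: L_def)
    qed
  qed
  obtain p0 where p0: "p0 \<in> surface_points S" using con unfolding connected_surface_def by blast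
  obtain B k0 where Bk: "L p0 = (B, k0)" by (cases "L p0")
  have const: "L p = (B, k0)" if "p \<in> surface_points S" for p
  proof -
    have "(p0, p) \<in> equiv_gen (flip_rel S \<union> glue_rel T S \<union> arc_rel S)"
      using con p0 that unfolding connected_surface_def by blast
    then have "L p0 = L p" by (rule equiv_gen_invariant) (rule L)
    then show ?thesis using Bk by simp
  qed
  have level: "cls (t, v) = B \<and> k = k0" if k: "k < w t v" for t v k
  proof -
    have "\<exists>u :: 4. u \<noteq> v" by (metis zero_neq_one)
    then obtain u where u: "v \<noteq> u" by metis
    then have "(t, v, u, k) \<in> surface_points S" using pw[of v u t] k by simp
    from const[OF this] show ?thesis using k by (simp add: L_def)
  qed
  obtain t0 v0 where B: "B = cls (t0, v0)" "0 < w t0 v0"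
  proof -
    obtain t u v k where p: "p0 = (t, u, v, k)" by (cases p0)
    then have "u \<noteq> v" "k < points S t u v" using p0 by auto
    then show thesis
      using that[of t u] that[of t v] Bk p pw[of u v t] by (auto simp: L_def split: if_splits)
  qed
  have wB: "w t v = of_bool ((t, v) \<in> B)" for t v
  proof (cases "(t, v) \<in> B")
    case True
    then have "0 < w t v" using w_cls[of t v t0 v0] B by simp
    \<comment> \<open>The innermost and the outermost triangle at \<open>v\<close> both have the
      level \<open>k0\<close>, so there is only one.\<close>
    then have "w t v - 1 = 0" using level[of 0 t v] level[of "w t v - 1" t v] by simp
    then show ?thesis using True \<open>0 < w t v\<close> by simp
  next
    case False
    then have "\<not> 0 < w t v" using level[of 0 t v] cls_refl[of "(t, v)"] by auto
    then show ?thesis using False by simp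
  qed
  show thesis
  proof (rule that)
    show "B \<in> boundary_components T"
      unfolding boundary_components_def B(1) cls_def by (rule quotientI) simp
    show "normally_parallel S B"
      unfolding normally_parallel_def normally_isotopic_def link_def using pw w wB by simp
  qed
qed

end

theorem theorem2p1:
  fixes T :: "'a::finite gluing" and \<theta> :: "'a \<Rightarrow> 4 \<Rightarrow> 4 \<Rightarrow> real" and S :: "'a surface"
  assumes "partially_flat_angled T \<theta>"
    and "orientable T"
    and "two_normal_surface T S"
    and "connected_surface T S"
    and "euler_characteristic T S \<ge> 0"
  shows "\<exists>B\<in>boundary_components T. torus T (link B) \<and> normally_parallel S B"
proof -
  have tri: "ideal_triangulation T" using assms(1) unfolding partially_flat_angled_def by blast
  interpret angled T S \<theta> by unfold_locales (use assms tri in auto)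
  obtain B where B: "B \<in> boundary_components T" "normally_parallel S B"
    using parallel_to_link[OF balanced_all[OF assms(5)] assms(4)] .
  have "euler_characteristic T S = 0" using euler_characteristic_nonpos assms(5) by simp
  \<comment> \<open>Connectedness and Euler characteristic pass from \<open>S\<close> to the link;
    its orientability comes from that of the triangulation.\<close>
  then have "torus T (link B)"
    using normally_isotopic_cong[of S "link B" T] B(2) assms(4) orientable_link[OF tri assms(2)]
    unfolding torus_def normally_parallel_def by simp
  with B show ?thesis by blast
qed

end
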